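(* Let $n\ge 2$. For every convex body $K\subset\mathbb{R}^n$, $$\Lambda(K)\ge \frac{\binom{2n}{n}}{(2n)^n}.$$
   Context: A convex body in $\mathbb{R}^n$ is a compact convex set with nonempty interior. A frame is an orthonormal basis $F=\{u_1,\ldots,u_n\}$ of $\mathbb{R}^n$. $K|u^\perp$ denotes the orthogonal projection of $K$ onto the hyperplane $u^\perp$ through the origin perpendicular to $u$. The LW-constant of $K$ is $$\Lambda(K)=\max_F \frac{\mathrm{vol}_n(K)^{n-1}}{\prod_{i=1}^n \mathrm{vol}_{n-1}(K|u_i^\perp)},$$ the maximum being over all frames $F=\{u_1,\ldots,u_n\}$ of $\mathbb{R}^n$ (it is attained). *)

theory Defs
  imports "HOL-Analysis.Analysis"
begin

definition convex_body :: "'a::euclidean_space set \<Rightarrow> bool" where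
  "convex_body K \<longleftrightarrow> compact K \<and> convex K \<and> interior K \<noteq> {}"

definition orthonormal_basis_of :: "'a::euclidean_space set \<Rightarrow> 'a set \<Rightarrow> bool" where
  "orthonormal_basis_of V B \<longleftrightarrow>
     pairwise orthogonal B \<and> (\<forall>b\<in>B. norm b = 1) \<and> span B = V"

abbreviation frame :: "'a::euclidean_space set \<Rightarrow> bool" where
  "frame F \<equiv> orthonormal_basis_of UNIV F"

text \<open>
  The \<open>dim V\<close>-dimensional Lebesgue measure on a linear subspace \<open>V\<close>, as a Borel measure on the
  ambient space: the image of the product of one-dimensional Lebesgue measures under the
  coordinate map of an orthonormal basis of \<open>V\<close>. This is how \<^const>\<open>lborel\<close> is constructed from
  \<^const>\<open>Basis\<close>. The result does not depend on the orthonormal basis chosen, because Lebesgue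
  measure is invariant under orthogonal maps.
\<close>

definition subspace_lborel :: "'a::euclidean_space set \<Rightarrow> 'a measure" where
  "subspace_lborel V =
     (let B = (SOME B. orthonormal_basis_of V B)
      in distr (\<Pi>\<^sub>M b\<in>B. (lborel :: real measure)) borel (\<lambda>f. \<Sum>b\<in>B. f b *\<^sub>R b))"

text \<open>Orthogonal projection onto the hyperplane \<open>{u}\<^sup>\<bottom>\<close>, for \<open>u \<noteq> 0\<close>.\<close>

definition hyperplane_proj :: "'a::euclidean_space \<Rightarrow> 'a \<Rightarrow> 'a" where
  "hyperplane_proj u x = x - ((x \<bullet> u) / (u \<bullet> u)) *\<^sub>R u"

definition proj_volume :: "'a::euclidean_space set \<Rightarrow> 'a \<Rightarrow> real" where
  "proj_volume K u = measure (subspace_lborel ({u}\<^sup>\<bottom>)) (hyperplane_proj u ` K)"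

definition LW_ratio :: "'a::euclidean_space set \<Rightarrow> 'a set \<Rightarrow> real" where
  "LW_ratio K F = measure lborel K ^ (DIM('a) - 1) / (\<Prod>u\<in>F. proj_volume K u)"

text \<open>
  For a convex body the ratio is bounded above (Loomis--Whitney), and it attains its maximum over
  the compact set of frames; the supremum below is that maximum. (\<^const>\<open>Max\<close> is restricted to
  finite sets.)
\<close>

definition LW_constant :: "'a::euclidean_space set \<Rightarrow> real" where
  "LW_constant K = (SUP F\<in>{F. frame F}. LW_ratio K F)"

end

theory Submission
  imports Defs
begin

text \<open>
  Let \<open>V = vol K\<close>, \<open>n = dim\<close>, \<open>p u = vol (K|u\<^sup>\<bottom>)\<close> and let \<open>g x = vol (K \<inter> (K + x))\<close> be the covariogram,
  so that the integral of \<open>g\<close> is \<open>V\<^sup>2\<close>. By Brunn--Minkowski \<open>g\<close> has convex symmetric superlevel sets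
  and its \<open>n\<close>-th root is concave along rays from the origin; as \<open>g\<close> has slope \<open>- p u\<close> at \<open>0\<close> in direction
  \<open>u\<close>, the set \<open>{g > s}\<close> has radius at most \<open>c(s) / p u\<close> in direction \<open>u\<close>, with
  \<open>c(s) = n V (1 - (s/V)\<^bsup>1/n\<^esup>)\<close>. Choose a frame greedily, each \<open>u\<^sub>i\<close> almost minimising \<open>p\<close> among the unit
  vectors orthogonal to its predecessors. The central sections of a symmetric convex set are its largest
  ones, so \<open>vol {g > s} \<le> (\<Prod>i. 2 c(s) / p u\<^sub>i)\<close> up to a factor close to \<open>1\<close>. Integrating over
  \<open>0 \<le> s \<le> V\<close> gives \<open>V\<^sup>2 \<le> (2 n V)\<^bsup>n\<^esup> V / ((2n choose n) (\<Prod>i. p u\<^sub>i))\<close>; this combines Zhang's inequality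
  for the polar projection body with a box estimate of its volume.
\<close>

subsection \<open>Lebesgue measure in the coordinates of a basis\<close>

text \<open>The construction behind \<open>subspace_lborel\<close> with the basis as an argument
  instead of a choice, so that proofs can go by induction over finite \<open>B\<close>, one
  direction at a time.\<close>

definition span_lborel :: "'a::euclidean_space set \<Rightarrow> 'a measure" where
  "span_lborel B = distr (\<Pi>\<^sub>M b\<in>B. (lborel :: real measure)) borel (\<lambda>f. \<Sum>b\<in>B. f b *\<^sub>R b)"

lemma sets_span_lborel [measurable_cong, simp]: "sets (span_lborel B) = sets borel"
  and space_span_lborel [simp]: "space (span_lborel B) = UNIV"
  by (simp_all add: span_lborel_def)

lemma measurable_span_coordinates [measurable]:
  "(\<lambda>f. \<Sum>b\<in>B. f b *\<^sub>R b) \<in> (\<Pi>\<^sub>M b\<in>B. (lborel :: real measure)) \<rightarrow>\<^sub>M borel"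
  for B :: "'a::euclidean_space set"
  by measurable

lemma span_lborel_Basis: "span_lborel Basis = lborel"
  by (simp add: span_lborel_def lborel_eq_real[symmetric] lborel_def[where 'a='a])

lemma nn_integral_span_lborel:
  assumes "f \<in> borel_measurable borel"
  shows "(\<integral>\<^sup>+x. f x \<partial>span_lborel B) =
    (\<integral>\<^sup>+c. f (\<Sum>b\<in>B. c b *\<^sub>R b) \<partial>(\<Pi>\<^sub>M b\<in>B. (lborel :: real measure)))"
  using assms by (simp add: span_lborel_def nn_integral_distr)

lemma emeasure_span_lborel_compl_span: "emeasure (span_lborel B) (- span B) = 0"
proof -
  have "(\<lambda>c. \<Sum>b\<in>B. c b *\<^sub>R b) -` (- span B) = {}"
    by (auto intro: span_sum span_scale span_base)
  then show ?thesis
    by (simp add: span_lborel_def emeasure_distr)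
qed

lemma AE_span_lborel: "AE x in span_lborel B. x \<in> span B"
  by (rule AE_I[where N = "- span B"]) (auto simp: emeasure_span_lborel_compl_span)

text \<open>The empty product is a point mass, which the coordinate map sends to the origin: the
  base case of the inductions over \<open>B\<close>.\<close>

lemma nn_integral_span_lborel_empty:
  assumes [measurable]: "f \<in> borel_measurable borel"
  shows "(\<integral>\<^sup>+x. f x \<partial>span_lborel {}) = f 0"
  by (simp add: nn_integral_span_lborel PiM_empty)

interpretation lborel_product: product_sigma_finite "\<lambda>_. lborel :: real measure"
  by standard

lemma sum_insert_fun_upd:
  fixes c :: "'a::real_vector \<Rightarrow> real"
  assumes B: "finite B" "u \<notin> B"
  shows "(\<Sum>b\<in>insert u B. (c(u := t)) b *\<^sub>R b) = (\<Sum>b\<in>B. c b *\<^sub>R b) + t *\<^sub>R u"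
proof -
  have "(\<Sum>b\<in>B. (c(u := t)) b *\<^sub>R b) = (\<Sum>b\<in>B. c b *\<^sub>R b)"
    using B by (intro sum.cong) auto
  with B show ?thesis by (simp add: add.commute)
qed

text \<open>Tonelli with the new direction inside: integration along the lines parallel to
  \<open>u\<close>, as projections along \<open>u\<close> require.\<close>

lemma nn_integral_span_lborel_insert_inner:
  assumes [measurable]: "f \<in> borel_measurable borel" and B: "finite B" "u \<notin> B"
  shows "(\<integral>\<^sup>+x. f x \<partial>span_lborel (insert u B)) =
    (\<integral>\<^sup>+x. (\<integral>\<^sup>+t. f (x + t *\<^sub>R u) \<partial>lborel) \<partial>span_lborel B)"
proof -
  have "(\<integral>\<^sup>+x. f x \<partial>span_lborel (insert u B)) =
    (\<integral>\<^sup>+c. (\<integral>\<^sup>+t. f (\<Sum>b\<in>insert u B. (c(u := t)) b *\<^sub>R b) \<partial>lborel) \<partial>(\<Pi>\<^sub>M b\<in>B. lborel))"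
    by (subst nn_integral_span_lborel) (use B in \<open>simp_all add: lborel_product.product_nn_integral_insert\<close>)
  also have "\<dots> = (\<integral>\<^sup>+c. (\<integral>\<^sup>+t. f ((\<Sum>b\<in>B. c b *\<^sub>R b) + t *\<^sub>R u) \<partial>lborel) \<partial>(\<Pi>\<^sub>M b\<in>B. lborel))"
    by (simp only: sum_insert_fun_upd[OF B])
  also have "\<dots> = (\<integral>\<^sup>+x. (\<integral>\<^sup>+t. f (x + t *\<^sub>R u) \<partial>lborel) \<partial>span_lborel B)"
    by (subst nn_integral_span_lborel) simp_all
  finally show ?thesis .
qed

text \<open>Tonelli in the other order: integration over slices parallel to \<open>span B\<close>,
  on which induction hypotheses act.\<close>

lemma nn_integral_span_lborel_insert:
  assumes [measurable]: "f \<in> borel_measurable borel" and B: "finite B" "u \<notin> B"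
  shows "(\<integral>\<^sup>+x. f x \<partial>span_lborel (insert u B)) =
    (\<integral>\<^sup>+t. (\<integral>\<^sup>+x. f (x + t *\<^sub>R u) \<partial>span_lborel B) \<partial>lborel)"
proof -
  have "(\<integral>\<^sup>+x. f x \<partial>span_lborel (insert u B)) =
    (\<integral>\<^sup>+t. (\<integral>\<^sup>+c. f (\<Sum>b\<in>insert u B. (c(u := t)) b *\<^sub>R b) \<partial>(\<Pi>\<^sub>M b\<in>B. lborel)) \<partial>lborel)"
    by (subst nn_integral_span_lborel) (use B in \<open>simp_all add: lborel_product.product_nn_integral_insert_rev\<close>)
  also have "\<dots> = (\<integral>\<^sup>+t. (\<integral>\<^sup>+c. f ((\<Sum>b\<in>B. c b *\<^sub>R b) + t *\<^sub>R u) \<partial>(\<Pi>\<^sub>M b\<in>B. lborel)) \<partial>lborel)"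
    by (simp only: sum_insert_fun_upd[OF B])
  also have "\<dots> = (\<integral>\<^sup>+t. (\<integral>\<^sup>+x. f (x + t *\<^sub>R u) \<partial>span_lborel B) \<partial>lborel)"
    by (subst nn_integral_span_lborel) simp_all
  finally show ?thesis .
qed

text \<open>The product of the coordinate measures is sigma-finite, while its image
  \<open>span_lborel B\<close> can fail to be so for dependent \<open>B\<close>; hence the integral
  is pulled back to coordinates.\<close>

lemma borel_measurable_nn_integral_span_lborel:
  fixes f :: "'a::euclidean_space \<Rightarrow> 'b::euclidean_space \<Rightarrow> ennreal"
  assumes [measurable]: "case_prod f \<in> borel_measurable (borel \<Otimes>\<^sub>M borel)" and B: "finite B"
  shows "(\<lambda>t. \<integral>\<^sup>+x. f t x \<partial>span_lborel B) \<in> borel_measurable borel"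
proof -
  interpret sigma_finite_measure "\<Pi>\<^sub>M b\<in>B. (lborel :: real measure)"
    by (rule lborel_product.sigma_finite) (rule B)
  have "(\<integral>\<^sup>+x. f t x \<partial>span_lborel B) =
      (\<integral>\<^sup>+c. f t (\<Sum>b\<in>B. c b *\<^sub>R b) \<partial>(\<Pi>\<^sub>M b\<in>B. (lborel :: real measure)))" for t
    by (rule nn_integral_span_lborel) measurable
  then show ?thesis by simp
qed

text \<open>A linear map keeps coordinates: \<open>T\<close> sends the vector with coordinates
  \<open>c\<close> over \<open>B\<close> to the one with the same coordinates over the image of
  \<open>B\<close>.\<close>

lemma nn_integral_span_lborel_image:
  assumes "finite B" "linear T" "inj_on T B" and "f \<in> borel_measurable borel"
  shows "(\<integral>\<^sup>+x. f x \<partial>span_lborel (T ` B)) = (\<integral>\<^sup>+x. f (T x) \<partial>span_lborel B)"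
  using assms
proof (induction B arbitrary: f rule: finite_induct)
  case empty
  have [measurable]: "T \<in> borel_measurable borel"
    using \<open>linear T\<close> by (intro borel_measurable_continuous_onI linear_continuous_on linear_conv_bounded_linear[THEN iffD1])
  note empty.prems(3)[measurable]
  show ?case using empty by (simp add: nn_integral_span_lborel_empty linear_0)
next
  case (insert u B)
  have [measurable]: "T \<in> borel_measurable borel"
    using \<open>linear T\<close> by (intro borel_measurable_continuous_onI linear_continuous_on linear_conv_bounded_linear[THEN iffD1])
  note insert.prems(3)[measurable]
  have "T u \<notin> T ` B" using insert by auto
  then have "(\<integral>\<^sup>+x. f x \<partial>span_lborel (T ` insert u B)) =
      (\<integral>\<^sup>+t. (\<integral>\<^sup>+x. f (x + t *\<^sub>R T u) \<partial>span_lborel (T ` B)) \<partial>lborel)"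
    using insert.hyps by (simp add: nn_integral_span_lborel_insert)
  also have "\<dots> = (\<integral>\<^sup>+t. (\<integral>\<^sup>+x. f (T x + t *\<^sub>R T u) \<partial>span_lborel B) \<partial>lborel)"
    by (intro nn_integral_cong insert.IH) (use insert.prems in auto)
  also have "\<dots> = (\<integral>\<^sup>+t. (\<integral>\<^sup>+x. f (T (x + t *\<^sub>R u)) \<partial>span_lborel B) \<partial>lborel)"
    using \<open>linear T\<close> by (simp add: linear_add linear_scale)
  also have "\<dots> = (\<integral>\<^sup>+x. f (T x) \<partial>span_lborel (insert u B))"
    using insert.hyps by (simp add: nn_integral_span_lborel_insert)
  finally show ?case .
qed

section \<open>Lebesgue measure as the normalised translation invariant measure\<close>

lemma nn_integral_lborel_shift:
  fixes f :: "'a::euclidean_space \<Rightarrow> ennreal"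
  assumes [measurable]: "f \<in> borel_measurable borel"
  shows "(\<integral>\<^sup>+x. f (a + x) \<partial>lborel) = (\<integral>\<^sup>+x. f x \<partial>lborel)"
proof -
  have "(\<integral>\<^sup>+x. f x \<partial>lborel) = (\<integral>\<^sup>+x. f x \<partial>distr lborel borel ((+) a))"
    by (simp add: lborel_distr_plus)
  then show ?thesis by (simp add: nn_integral_distr)
qed

lemma nn_integral_lborel_uminus:
  fixes f :: "'a::euclidean_space \<Rightarrow> ennreal"
  assumes [measurable]: "f \<in> borel_measurable borel"
  shows "(\<integral>\<^sup>+x. f (- x) \<partial>lborel) = (\<integral>\<^sup>+x. f x \<partial>lborel)"
proof -
  have "(\<integral>\<^sup>+x. f x \<partial>lborel) = (\<integral>\<^sup>+x. f x \<partial>density (distr lborel borel (\<lambda>x. 0 + (-1) *\<^sub>R x)) (\<lambda>_. \<bar>-1::real\<bar>^DIM('a)))"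
    by (rule arg_cong[where f = "\<lambda>M. integral\<^sup>N M f"], rule lborel_affine) simp
  also have "\<dots> = (\<integral>\<^sup>+x. f (- x) \<partial>lborel)"
    by (simp add: nn_integral_density nn_integral_distr)
  finally show ?thesis by simp
qed

(* Computing the measure of {(x, y). x \<in> ball 0 1 \<and> x + y \<in> A} in both orders shows that M
   and lborel are proportional. *)
lemma translation_invariant_eq_lborel:
  fixes M :: "'a::euclidean_space measure"
  assumes [measurable_cong]: "sets M = sets borel" and "sigma_finite_measure M"
    and inv: "\<And>f a. f \<in> borel_measurable borel \<Longrightarrow> (\<integral>\<^sup>+x. f (a + x) \<partial>M) = (\<integral>\<^sup>+x. f x \<partial>M)"
    and ball: "emeasure M (ball 0 1) = emeasure lborel (ball (0::'a) 1)"
  shows "M = lborel"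
proof (rule measure_eqI)
  interpret M: sigma_finite_measure M by fact
  interpret P: pair_sigma_finite M lborel by standard
  fix A assume "A \<in> sets M"
  then have [measurable]: "A \<in> sets borel" by (simp add: assms)
  let ?B = "ball (0::'a) 1"
  have [measurable]: "?B \<in> sets M" by (simp add: assms(1))
  have "emeasure M ?B * emeasure lborel A =
      (\<integral>\<^sup>+x. (\<integral>\<^sup>+y. indicator ?B x * indicator A y \<partial>lborel) \<partial>M)"
    by (simp add: nn_integral_cmult nn_integral_multc)
  also have "\<dots> = (\<integral>\<^sup>+x. (\<integral>\<^sup>+y. indicator ?B x * indicator A (x + y) \<partial>lborel) \<partial>M)"
    by (intro nn_integral_cong nn_integral_lborel_shift[symmetric]) simp
  also have "\<dots> = (\<integral>\<^sup>+y. (\<integral>\<^sup>+x. indicator ?B x * indicator A (x + y) \<partial>M) \<partial>lborel)"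
    by (rule P.Fubini'[symmetric]) measurable
  also have "\<dots> = (\<integral>\<^sup>+y. (\<integral>\<^sup>+x. indicator ?B (-y + x) * indicator A (-y + x + y) \<partial>M) \<partial>lborel)"
    by (intro nn_integral_cong inv[symmetric]) simp
  also have "\<dots> = (\<integral>\<^sup>+y. (\<integral>\<^sup>+x. indicator ?B (-y + x) * indicator A x \<partial>M) \<partial>lborel)"
    by (simp add: algebra_simps)
  also have "\<dots> = (\<integral>\<^sup>+x. (\<integral>\<^sup>+y. indicator ?B (-y + x) * indicator A x \<partial>lborel) \<partial>M)"
    by (rule P.Fubini') measurable
  also have "\<dots> = (\<integral>\<^sup>+x. emeasure lborel ?B * indicator A x \<partial>M)"
  proof (intro nn_integral_cong)
    fix x
    have "(\<integral>\<^sup>+y. indicator ?B (-y + x) * indicator A x \<partial>lborel) = (\<integral>\<^sup>+y. indicator ?B (x + y) * indicator A x \<partial>lborel)"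
      by (subst nn_integral_lborel_uminus[symmetric]) (simp_all add: add.commute)
    also have "\<dots> = (\<integral>\<^sup>+y. indicator ?B y * indicator A x \<partial>lborel)"
      by (rule nn_integral_lborel_shift) simp
    finally show "(\<integral>\<^sup>+y. indicator ?B (-y + x) * indicator A x \<partial>lborel) = emeasure lborel ?B * indicator A x"
      by (simp add: nn_integral_multc)
  qed
  also have "\<dots> = emeasure lborel ?B * emeasure M A"
    by (simp add: nn_integral_cmult)
  finally have eq: "emeasure lborel ?B * emeasure lborel A = emeasure lborel ?B * emeasure M A"
    by (simp add: ball)
  moreover have "emeasure lborel ?B \<noteq> 0" "emeasure lborel ?B \<noteq> \<infinity>"
    using unit_ball_vol_pos[of "real DIM('a)"] by (simp_all add: emeasure_ball del: unit_ball_vol_pos)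
  ultimately show "emeasure M A = emeasure lborel A"
    by (metis ennreal_mult_cancel_left infinity_ennreal_def)
qed (simp add: assms)

section \<open>Orthonormal bases, frames and integration along a hyperplane\<close>

lemma orthonormal_basis_of_independent:
  assumes "orthonormal_basis_of V B"
  shows "independent B"
  using assms unfolding orthonormal_basis_of_def
  by (intro pairwise_orthogonal_independent) auto

lemma orthonormal_basis_of_finite: "orthonormal_basis_of V B \<Longrightarrow> finite B"
  using orthonormal_basis_of_independent independent_imp_finite by blast

lemma orthonormal_basis_of_card: "orthonormal_basis_of V B \<Longrightarrow> card B = dim V"
  using orthonormal_basis_of_independent[of V B] dim_span_eq_card_independent[of B]
  by (simp add: orthonormal_basis_of_def)

lemma orthonormal_basis_of_exists: "subspace V \<Longrightarrow> \<exists>B. orthonormal_basis_of V B"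
  unfolding orthonormal_basis_of_def by (metis orthonormal_basis_subspace)

text \<open>Some orthogonal map \<open>T\<close> carries \<open>Basis\<close> to \<open>F\<close>,
  so the measure is the image of \<open>lborel\<close> under \<open>T\<close>. It is translation
  invariant since \<open>T\<close> is linear and onto, and correctly normalised since
  \<open>T\<close> preserves norms.\<close>

lemma span_lborel_frame:
  fixes F :: "'a::euclidean_space set"
  assumes F: "frame F"
  shows "span_lborel F = lborel"
proof -
  have "card (Basis :: 'a set) = card F"
    using orthonormal_basis_of_card[OF F] by simp
  then obtain e where e: "bij_betw e (Basis :: 'a set) F"
    using orthonormal_basis_of_finite[OF F] by (metis bij_betw_iff_card finite_Basis)
  define T where "T x = (\<Sum>b\<in>Basis. (x \<bullet> b) *\<^sub>R e b)" for x :: 'a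
  have Te: "T b = e b" if "b \<in> Basis" for b
    using that by (simp add: T_def inner_Basis if_distrib[of "\<lambda>x. x *\<^sub>R _"] cong: if_cong)
  have inner_e: "e b \<bullet> e b' = (if b = b' then 1 else 0)" if "b \<in> Basis" "b' \<in> Basis" for b b'
    using that F e unfolding orthonormal_basis_of_def pairwise_def orthogonal_def
    by (metis bij_betw_apply bij_betw_inv_into_left norm_eq_1)
  have "linear T"
    unfolding T_def by (intro linearI) (simp_all add: algebra_simps sum.distrib scaleR_sum_right)
  moreover have "T v \<bullet> T w = v \<bullet> w" for v w
    by (simp add: T_def inner_sum_left inner_sum_right inner_e euclidean_inner[of v w]
        if_distrib[of "\<lambda>x. _ * x"] mult.commute cong: if_cong)
  ultimately have T: "orthogonal_transformation T"
    by (simp add: orthogonal_transformation_def)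
  note [measurable] = borel_measurable_continuous_onI[OF linear_continuous_on[OF \<open>linear T\<close>[unfolded linear_conv_bounded_linear]]]
  have TF: "F = T ` Basis" using e Te by (auto simp: bij_betw_def)
  have int: "(\<integral>\<^sup>+x. f x \<partial>span_lborel F) = (\<integral>\<^sup>+x. f (T x) \<partial>lborel)"
    if "f \<in> borel_measurable borel" for f
    unfolding TF using that \<open>linear T\<close> orthogonal_transformation_inj[OF T]
    by (subst nn_integral_span_lborel_image) (auto simp: span_lborel_Basis intro: inj_on_subset)
  \<comment> \<open>Radius 1 fixes the normalisation; the balls with radius a natural number give
    sigma-finiteness.\<close>
  have ball: "emeasure (span_lborel F) (ball 0 r) = emeasure lborel (ball (0::'a) r)" for r
  proof -
    have "emeasure (span_lborel F) (ball 0 r) = (\<integral>\<^sup>+x. indicator (ball 0 r) (T x) \<partial>lborel)"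
      by (subst int[OF borel_measurable_indicator, symmetric]) simp_all
    also have "\<dots> = (\<integral>\<^sup>+x. indicator (ball (0::'a) r) x \<partial>lborel)"
      by (intro nn_integral_cong) (simp add: indicator_def orthogonal_transformation_norm[OF T])
    finally show ?thesis by simp
  qed
  show ?thesis
  proof (rule translation_invariant_eq_lborel)
    show "sigma_finite_measure (span_lborel F)"
    proof
      show "\<exists>A. countable A \<and> A \<subseteq> sets (span_lborel F) \<and> \<Union> A = space (span_lborel F) \<and>
          (\<forall>a\<in>A. emeasure (span_lborel F) a \<noteq> \<infinity>)"
      proof (intro exI[of _ "range (\<lambda>n::nat. ball 0 (real n))"] conjI)
        show "\<Union> (range (\<lambda>n::nat. ball (0::'a) (real n))) = space (span_lborel F)"
          using reals_Archimedean2 by auto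
      qed (auto simp: ball emeasure_ball)
    qed
    show "(\<integral>\<^sup>+x. f (a + x) \<partial>span_lborel F) = (\<integral>\<^sup>+x. f x \<partial>span_lborel F)"
      if [measurable]: "f \<in> borel_measurable borel" for f a
    proof -
      obtain a' where a': "a = T a'"
        using orthogonal_transformation_surj[OF T] by (metis surjD)
      have "(\<integral>\<^sup>+x. f (a + x) \<partial>span_lborel F) = (\<integral>\<^sup>+x. f (T (a' + x)) \<partial>lborel)"
        using \<open>linear T\<close> by (simp add: int a' linear_add)
      also have "\<dots> = (\<integral>\<^sup>+x. f (T x) \<partial>lborel)"
        by (rule nn_integral_lborel_shift) simp
      finally show ?thesis by (simp add: int)
    qed
  qed (simp_all add: ball)
qed

lemma subspace_lborel_orthonormal:
  assumes "subspace V"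
  obtains B where "orthonormal_basis_of V B" "subspace_lborel V = span_lborel B"
proof
  show "orthonormal_basis_of V (SOME B. orthonormal_basis_of V B)"
    using orthonormal_basis_of_exists[OF assms] by (rule someI_ex)
  show "subspace_lborel V = span_lborel (SOME B. orthonormal_basis_of V B)"
    by (simp add: subspace_lborel_def span_lborel_def Let_def)
qed

text \<open>A vector of \<open>W\<close> splits into its component along \<open>u\<close> and a rest
  in \<open>W\<close> orthogonal to \<open>u\<close>. Frames are built one vector at a time by this
  step.\<close>

lemma orthonormal_basis_of_insert:
  assumes W: "subspace W" "u \<in> W" and u: "norm u = 1"
    and B: "orthonormal_basis_of (W \<inter> {u}\<^sup>\<bottom>) B"
  shows "u \<notin> B" "orthonormal_basis_of W (insert u B)"
proof -
  have BW: "B \<subseteq> W" "\<And>b. b \<in> B \<Longrightarrow> orthogonal u b"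
    using B span_base unfolding orthonormal_basis_of_def orthogonal_comp_def by blast+
  show "u \<notin> B" using BW(2)[of u] u by (auto simp: orthogonal_def)
  have "span (insert u B) = W"
  proof
    show "span (insert u B) \<subseteq> W"
      using W BW by (intro span_minimal) auto
    show "W \<subseteq> span (insert u B)"
    proof
      fix x assume "x \<in> W"
      then have "x - (x \<bullet> u) *\<^sub>R u \<in> W \<inter> {u}\<^sup>\<bottom>"
        using W u by (auto simp: subspace_diff subspace_scale orthogonal_comp_def orthogonal_def
            inner_diff_right inner_commute norm_eq_1)
      then have "x - (x \<bullet> u) *\<^sub>R u \<in> span (insert u B)"
        using B span_mono[of B "insert u B"] by (auto simp: orthonormal_basis_of_def)
      moreover have "(x \<bullet> u) *\<^sub>R u \<in> span (insert u B)"
        by (intro span_scale span_base) simp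
      ultimately have "x - (x \<bullet> u) *\<^sub>R u + (x \<bullet> u) *\<^sub>R u \<in> span (insert u B)"
        by (rule span_add)
      then show "x \<in> span (insert u B)" by simp
    qed
  qed
  with B BW u show "orthonormal_basis_of W (insert u B)"
    by (auto simp: orthonormal_basis_of_def pairwise_insert orthogonal_commute)
qed

text \<open>An orthonormal basis of the hyperplane together with \<open>u\<close> is a frame, whose
  measure is \<open>lborel\<close>; the rest is Tonelli.\<close>

lemma nn_integral_lborel_hyperplane:
  fixes u :: "'a::euclidean_space"
  assumes f: "f \<in> borel_measurable borel" and u: "norm u = 1"
  shows "(\<integral>\<^sup>+x. f x \<partial>lborel) =
    (\<integral>\<^sup>+x. (\<integral>\<^sup>+t. f (x + t *\<^sub>R u) \<partial>lborel) \<partial>subspace_lborel ({u}\<^sup>\<bottom>))"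
proof -
  obtain B where B: "orthonormal_basis_of ({u}\<^sup>\<bottom>) B" "subspace_lborel ({u}\<^sup>\<bottom>) = span_lborel B"
    using subspace_lborel_orthonormal subspace_orthogonal_comp by blast
  have "u \<notin> B" "frame (insert u B)"
    using orthonormal_basis_of_insert[of UNIV u B] B u by auto
  then have "(\<integral>\<^sup>+x. f x \<partial>lborel) = (\<integral>\<^sup>+x. f x \<partial>span_lborel (insert u B))"
    by (simp add: span_lborel_frame)
  with \<open>u \<notin> B\<close> show ?thesis
    using nn_integral_span_lborel_insert_inner[OF f orthonormal_basis_of_finite[OF B(1)]] B(2) by simp
qed

lemma sets_subspace_lborel [measurable_cong, simp]: "sets (subspace_lborel V) = sets borel"
  and space_subspace_lborel [simp]: "space (subspace_lborel V) = UNIV"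
  by (simp_all add: subspace_lborel_def Let_def)

lemma AE_subspace_lborel:
  assumes "subspace V"
  shows "AE x in subspace_lborel V. x \<in> V"
proof -
  obtain B where "orthonormal_basis_of V B" "subspace_lborel V = span_lborel B"
    using subspace_lborel_orthonormal[OF assms] .
  then show ?thesis
    using AE_span_lborel[of B] by (metis orthonormal_basis_of_def)
qed

section \<open>Orthogonal projections onto hyperplanes and their volumes\<close>

lemma hyperplane_proj_eq: "norm u = 1 \<Longrightarrow> hyperplane_proj u x = x - (x \<bullet> u) *\<^sub>R u"
  by (simp add: hyperplane_proj_def norm_eq_1)

lemma hyperplane_proj_in: "norm u = 1 \<Longrightarrow> hyperplane_proj u x \<in> {u}\<^sup>\<bottom>"
  by (simp add: hyperplane_proj_eq orthogonal_comp_def orthogonal_def inner_diff_right inner_commute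
      norm_eq_1)

lemma hyperplane_proj_add:
  assumes "norm u = 1" "x \<in> {u}\<^sup>\<bottom>"
  shows "hyperplane_proj u (x + t *\<^sub>R u) = x" "(x + t *\<^sub>R u) \<bullet> u = t"
  using assms by (simp_all add: hyperplane_proj_eq orthogonal_comp_def orthogonal_def algebra_simps
      inner_commute norm_eq_1)

lemma continuous_hyperplane_proj: "norm u = 1 \<Longrightarrow> continuous_on A (hyperplane_proj u)"
  by (subst continuous_on_cong[OF refl hyperplane_proj_eq]) (auto intro!: continuous_intros)

lemma linear_hyperplane_proj: "linear (hyperplane_proj u)"
  by (intro linearI) (simp_all add: hyperplane_proj_def algebra_simps add_divide_distrib)

text \<open>Translates between the measure on a hyperplane and \<open>lborel\<close>: a cylinder of
  unit height has the measure of its base. Finiteness and scaling are thereby inherited from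
  \<open>lborel\<close>.\<close>

lemma emeasure_lborel_cylinder:
  fixes u :: "'a::euclidean_space"
  assumes u: "norm u = 1" and [measurable]: "S \<in> sets borel" and "a \<le> b"
  shows "emeasure lborel {x. hyperplane_proj u x \<in> S \<and> x \<bullet> u \<in> {a..b}} =
    ennreal (b - a) * emeasure (subspace_lborel ({u}\<^sup>\<bottom>)) S"
proof -
  let ?C = "{x. hyperplane_proj u x \<in> S \<and> x \<bullet> u \<in> {a..b}}"
  have [measurable]: "hyperplane_proj u \<in> borel_measurable borel"
    using u by (intro borel_measurable_continuous_onI continuous_hyperplane_proj)
  have [measurable]: "?C \<in> sets borel" by measurable
  have "emeasure lborel ?C = (\<integral>\<^sup>+x. indicator ?C x \<partial>lborel)" by simp
  also have "\<dots> = (\<integral>\<^sup>+x. (\<integral>\<^sup>+t. indicator ?C (x + t *\<^sub>R u) \<partial>lborel) \<partial>subspace_lborel ({u}\<^sup>\<bottom>))"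
    by (rule nn_integral_lborel_hyperplane[OF _ u]) simp
  also have "\<dots> = (\<integral>\<^sup>+x. ennreal (b - a) * indicator S x \<partial>subspace_lborel ({u}\<^sup>\<bottom>))"
  proof (rule nn_integral_cong_AE, use AE_subspace_lborel[OF subspace_orthogonal_comp] in eventually_elim)
    fix x assume x: "x \<in> {u}\<^sup>\<bottom>"
    have "(\<integral>\<^sup>+t. indicator ?C (x + t *\<^sub>R u) \<partial>lborel) = (\<integral>\<^sup>+t. indicator {a..b} t * indicator S x \<partial>lborel)"
      using x u by (intro nn_integral_cong) (simp add: hyperplane_proj_add split: split_indicator)
    also have "\<dots> = ennreal (b - a) * indicator S x"
      using \<open>a \<le> b\<close> by (simp add: nn_integral_multc)
    finally show "(\<integral>\<^sup>+t. indicator ?C (x + t *\<^sub>R u) \<partial>lborel) = ennreal (b - a) * indicator S x" .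
  qed
  also have "\<dots> = ennreal (b - a) * emeasure (subspace_lborel ({u}\<^sup>\<bottom>)) S"
    by (simp add: nn_integral_cmult)
  finally show ?thesis .
qed

lemma compact_hyperplane_proj: "compact K \<Longrightarrow> norm u = 1 \<Longrightarrow> compact (hyperplane_proj u ` K)"
  by (intro compact_continuous_image continuous_hyperplane_proj)

text \<open>\<open>measure\<close> is 0 on sets of infinite measure, so \<open>proj_volume\<close>
  is meaningful only once finiteness is known. It holds because the unit cylinder over the bounded
  projection lies in a ball.\<close>

lemma emeasure_hyperplane_proj:
  assumes K: "compact K" and u: "norm u = 1"
  shows "emeasure (subspace_lborel ({u}\<^sup>\<bottom>)) (hyperplane_proj u ` K) = ennreal (proj_volume K u)"
proof -
  let ?P = "hyperplane_proj u ` K"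
  have P: "compact ?P" using compact_hyperplane_proj[OF K u] .
  then obtain r where r: "\<And>x. x \<in> ?P \<Longrightarrow> norm x \<le> r"
    using compact_imp_bounded bounded_iff by metis
  have "{x. hyperplane_proj u x \<in> ?P \<and> x \<bullet> u \<in> {0..1}} \<subseteq> cball 0 (r + 1)"
  proof
    fix x assume "x \<in> {x. hyperplane_proj u x \<in> ?P \<and> x \<bullet> u \<in> {0..1}}"
    then have x: "x \<bullet> u \<in> {0..1}" "hyperplane_proj u x \<in> ?P" by auto
    have "x = hyperplane_proj u x + (x \<bullet> u) *\<^sub>R u"
      by (simp add: hyperplane_proj_eq[OF u])
    then have "norm x \<le> norm (hyperplane_proj u x) + norm ((x \<bullet> u) *\<^sub>R u)"
      by (metis norm_triangle_ineq)
    also have "\<dots> \<le> r + 1" using x u r by (intro add_mono) auto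
    finally show "x \<in> cball 0 (r + 1)" by simp
  qed
  then have "emeasure lborel {x. hyperplane_proj u x \<in> ?P \<and> x \<bullet> u \<in> {0..1}} \<le> emeasure lborel (cball (0::'a) (r + 1))"
    by (intro emeasure_mono) auto
  also have "\<dots> < \<infinity>" by (rule emeasure_bounded_finite) (rule bounded_cball)
  also have "emeasure lborel {x. hyperplane_proj u x \<in> ?P \<and> x \<bullet> u \<in> {0..1}} =
      emeasure (subspace_lborel ({u}\<^sup>\<bottom>)) ?P"
    using emeasure_lborel_cylinder[OF u borel_compact[OF P], of 0 1] by simp
  finally show ?thesis
    by (simp add: proj_volume_def emeasure_eq_ennreal_measure)
qed

subsection \<open>The Prekopa--Leindler and Brunn--Minkowski inequalities\<close>

lemma emeasure_lborel_affine_image_real: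
  fixes A :: "real set"
  assumes [measurable]: "A \<in> sets borel" and "c > 0"
  shows "emeasure lborel ((\<lambda>x. t + c * x) ` A) = ennreal c * emeasure lborel A" (is ?e)
    and "(\<lambda>x. t + c * x) ` A \<in> sets borel" (is ?m)
proof -
  have eq: "(\<lambda>x. t + c * x) ` A = (\<lambda>x. (x - t) / c) -` A \<inter> space borel"
    using \<open>c > 0\<close> by (force simp: field_simps image_iff)
  show ?m unfolding eq by measurable
  then have "emeasure lborel ((\<lambda>x. t + c * x) ` A) = (\<integral>\<^sup>+x. indicator ((\<lambda>x. t + c * x) ` A) x \<partial>lborel)"
    by simp
  also have "\<dots> = \<bar>c\<bar> * (\<integral>\<^sup>+x. indicator ((\<lambda>x. t + c * x) ` A) (t + c * x) \<partial>lborel)"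
    using \<open>?m\<close> \<open>c > 0\<close> by (intro nn_integral_real_affine) auto
  also have "(\<integral>\<^sup>+x. indicator ((\<lambda>x. t + c * x) ` A) (t + c * x) \<partial>lborel) = (\<integral>\<^sup>+x. indicator A x \<partial>lborel)"
    using \<open>c > 0\<close> by (intro nn_integral_cong) (auto simp: indicator_def)
  finally show ?e using \<open>c > 0\<close> by simp
qed

(* Cut A at a near-maximal point a and B at a near-minimal point b: the translates of the scaled
   copies then lie on opposite sides of (1 - l) * a + l * b. *)
lemma brunn_minkowski_real_bounded:
  fixes A B C :: "real set"
  assumes [measurable]: "A \<in> sets borel" "B \<in> sets borel" "C \<in> sets borel"
    and ne: "A \<noteq> {}" "B \<noteq> {}" and bdd: "bounded A" "bounded B"
    and l: "0 < l" "l < 1"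
    and sub: "\<And>x y. x \<in> A \<Longrightarrow> y \<in> B \<Longrightarrow> (1 - l) * x + l * y \<in> C"
  shows "ennreal (1 - l) * emeasure lborel A + ennreal l * emeasure lborel B \<le> emeasure lborel C"
proof (rule ennreal_le_epsilon)
  fix e :: real assume "e > 0"
  obtain a where a: "a \<in> A" "\<And>x. x \<in> A \<Longrightarrow> x < a + e"
  proof -
    obtain a where "a \<in> A" "Sup A - e < a"
      using \<open>e > 0\<close> ne less_cSupD[of A "Sup A - e"] by auto
    moreover have "x \<le> Sup A" if "x \<in> A" for x
      using that bdd(1) by (intro cSup_upper bounded_imp_bdd_above)
    ultimately show ?thesis using that by fastforce
  qed
  obtain b where b: "b \<in> B" "\<And>x. x \<in> B \<Longrightarrow> b - e < x"
  proof -
    obtain b where "b \<in> B" "b < Inf B + e"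
      using \<open>e > 0\<close> ne cInf_lessD[of B "Inf B + e"] by auto
    moreover have "Inf B \<le> x" if "x \<in> B" for x
      using that bdd(2) by (intro cInf_lower bounded_imp_bdd_below)
    ultimately show ?thesis using that by fastforce
  qed
  let ?A = "(\<lambda>x. l * b + (1 - l) * x) ` (A \<inter> {..a})"
  \<comment> \<open>\<open>b\<close> is excluded because \<open>{..a}\<close> keeps
    \<open>a\<close>: the two images would otherwise share the point
    \<open>(1 - l) * a + l * b\<close>.\<close>
  let ?B = "(\<lambda>y. (1 - l) * a + l * y) ` (B \<inter> {b<..})"
  have "emeasure lborel A \<le> emeasure lborel ((A \<inter> {..a}) \<union> {a..a+e})"
    using a(2) by (intro emeasure_mono) force+
  also have "\<dots> \<le> emeasure lborel (A \<inter> {..a}) + emeasure lborel {a..a+e}"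
    by (intro emeasure_subadditive) auto
  finally have A: "emeasure lborel A \<le> emeasure lborel (A \<inter> {..a}) + ennreal e"
    using \<open>e > 0\<close> by simp
  have "emeasure lborel B \<le> emeasure lborel ((B \<inter> {b<..}) \<union> {b-e..b})"
    using b(2) by (intro emeasure_mono) force+
  also have "\<dots> \<le> emeasure lborel (B \<inter> {b<..}) + emeasure lborel {b-e..b}"
    by (intro emeasure_subadditive) auto
  finally have B: "emeasure lborel B \<le> emeasure lborel (B \<inter> {b<..}) + ennreal e"
    using \<open>e > 0\<close> by simp
  have "?A \<inter> ?B = {}"
  proof -
    have "l * b + (1 - l) * x \<noteq> (1 - l) * a + l * y" if "x \<le> a" "b < y" for x y
    proof -
      have "(1 - l) * x \<le> (1 - l) * a" "l * b < l * y" using that l by auto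
      then show ?thesis by linarith
    qed
    then show ?thesis by auto
  qed
  have "ennreal (1 - l) * emeasure lborel A + ennreal l * emeasure lborel B
      \<le> ennreal (1 - l) * (emeasure lborel (A \<inter> {..a}) + ennreal e)
        + ennreal l * (emeasure lborel (B \<inter> {b<..}) + ennreal e)"
    by (intro add_mono mult_left_mono A B) auto
  also have "\<dots> = ennreal (1 - l) * emeasure lborel (A \<inter> {..a}) + ennreal l * emeasure lborel (B \<inter> {b<..})
      + (ennreal (1 - l) + ennreal l) * ennreal e"
    by (simp add: algebra_simps)
  also have "(ennreal (1 - l) + ennreal l) * ennreal e = ennreal e"
    using l by (simp flip: ennreal_plus)
  also have "ennreal (1 - l) * emeasure lborel (A \<inter> {..a}) + ennreal l * emeasure lborel (B \<inter> {b<..})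
      = emeasure lborel ?A + emeasure lborel ?B"
    using l by (simp add: emeasure_lborel_affine_image_real)
  also have "\<dots> = emeasure lborel (?A \<union> ?B)"
    using l \<open>?A \<inter> ?B = {}\<close> by (intro plus_emeasure) (simp_all add: emeasure_lborel_affine_image_real)
  also have "\<dots> \<le> emeasure lborel C"
    using sub a(1) b(1) by (intro emeasure_mono) (auto simp: add.commute)
  finally show "ennreal (1 - l) * emeasure lborel A + ennreal l * emeasure lborel B \<le> emeasure lborel C + ennreal e"
    by (simp add: add_right_mono)
qed

text \<open>The bounded case for truncations to \<open>{- real n..real n}\<close>, followed by
  monotone limits. From \<open>N\<close> on, the truncations contain the chosen points
  \<open>x\<close> and \<open>y\<close> and are nonempty.\<close>

lemma brunn_minkowski_real:
  fixes A B C :: "real set"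
  assumes [measurable]: "A \<in> sets borel" "B \<in> sets borel" "C \<in> sets borel"
    and ne: "A \<noteq> {}" "B \<noteq> {}"
    and l: "0 < l" "l < 1"
    and sub: "\<And>x y. x \<in> A \<Longrightarrow> y \<in> B \<Longrightarrow> (1 - l) * x + l * y \<in> C"
  shows "ennreal (1 - l) * emeasure lborel A + ennreal l * emeasure lborel B \<le> emeasure lborel C"
proof -
  have lim: "(\<lambda>n. emeasure lborel (S \<inter> {- real n..real n})) \<longlonglongrightarrow> emeasure lborel S"
    if [measurable]: "S \<in> sets borel" for S :: "real set"
  proof -
    have "(\<lambda>n. emeasure lborel (S \<inter> {- real n..real n})) \<longlonglongrightarrow> emeasure lborel (\<Union>n. S \<inter> {- real n..real n})"
      by (rule Lim_emeasure_incseq) (auto simp: incseq_def)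
    also have "(\<Union>n. S \<inter> {- real n..real n}) = S"
    proof safe
      fix x assume "x \<in> S"
      obtain n :: nat where "\<bar>x\<bar> \<le> real n" using real_arch_simple by blast
      with \<open>x \<in> S\<close> show "x \<in> (\<Union>n. S \<inter> {- real n..real n})"
      by (auto intro!: exI[of _ n])
    qed
    finally show ?thesis .
  qed
  obtain x y where xy: "x \<in> A" "y \<in> B" using ne by auto
  obtain N :: nat where N: "max \<bar>x\<bar> \<bar>y\<bar> \<le> real N" using real_arch_simple by blast
  have "ennreal (1 - l) * emeasure lborel (A \<inter> {- real n..real n}) + ennreal l * emeasure lborel (B \<inter> {- real n..real n})
      \<le> emeasure lborel C" if "n \<ge> N" for n
  proof (rule brunn_minkowski_real_bounded)
    show "bounded (A \<inter> {- real n..real n})" "bounded (B \<inter> {- real n..real n})"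
      by (auto intro: bounded_subset[OF bounded_closed_interval])
    have "\<bar>x\<bar> \<le> real n" "\<bar>y\<bar> \<le> real n" using N that by auto
    then have "x \<in> A \<inter> {- real n..real n}" "y \<in> B \<inter> {- real n..real n}"
      using xy by auto
    then show "A \<inter> {- real n..real n} \<noteq> {}" "B \<inter> {- real n..real n} \<noteq> {}" by auto
  qed (use l sub in auto)
  then show ?thesis
    by (intro LIMSEQ_le_const2[OF tendsto_add[OF ennreal_tendsto_cmult[OF _ lim] ennreal_tendsto_cmult[OF _ lim]]])
      auto
qed

text \<open>
  \<open>geom_le l p q r\<close> encodes \<open>p\<^bsup>1-l\<^esup> * q\<^bsup>l\<^esup> \<le> r\<close> for extended nonnegative reals, on which \<open>powr\<close> is
  not available, with the convention \<open>0 * \<infinity> = 0\<close>.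
\<close>

definition geom_le :: "real \<Rightarrow> ennreal \<Rightarrow> ennreal \<Rightarrow> ennreal \<Rightarrow> bool" where
  "geom_le l p q r \<longleftrightarrow> (\<forall>a b. 0 < a \<longrightarrow> 0 < b \<longrightarrow> ennreal a < p \<longrightarrow> ennreal b < q \<longrightarrow>
     ennreal (a powr (1 - l) * b powr l) \<le> r)"

lemma geom_leD:
  "geom_le l p q r \<Longrightarrow> 0 < a \<Longrightarrow> 0 < b \<Longrightarrow> ennreal a < p \<Longrightarrow> ennreal b < q \<Longrightarrow>
    ennreal (a powr (1 - l) * b powr l) \<le> r"
  by (simp add: geom_le_def)

lemma geom_le_mono: "geom_le l p q r \<Longrightarrow> p' \<le> p \<Longrightarrow> q' \<le> q \<Longrightarrow> geom_le l p' q' r"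
  unfolding geom_le_def by (meson less_le_trans)

section \<open>The Prekopa--Leindler inequality, from level sets on the line to all
  dimensions\<close>

lemma ennreal_between_real:
  fixes p q :: ennreal
  assumes "p < q"
  obtains r where "p < ennreal r" "ennreal r < q"
  using dense[OF assms] by (metis ennreal_cases top.extremum_strict top_greatest leD)

text \<open>The levels are rescaled to the unit interval, so that functions with different bounds
  can be compared at the same \<open>s\<close>.\<close>

lemma nn_integral_layer_cake:
  fixes f :: "real \<Rightarrow> ennreal"
  assumes [measurable]: "f \<in> borel_measurable borel" and M: "0 < M" and le: "\<And>x. f x \<le> ennreal M"
  shows "(\<integral>\<^sup>+x. f x \<partial>lborel) =
    ennreal M * (\<integral>\<^sup>+s. emeasure lborel {x. ennreal (s * M) < f x} * indicator {0<..<1} s \<partial>lborel)"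
proof -
  have "(\<integral>\<^sup>+s. emeasure lborel {x. ennreal (s * M) < f x} * indicator {0<..<1} s \<partial>lborel) =
      (\<integral>\<^sup>+s. (\<integral>\<^sup>+x. indicator {x. ennreal (s * M) < f x} x * indicator {0<..<1} s \<partial>lborel) \<partial>lborel)"
    by (simp add: nn_integral_multc)
  also have "\<dots> = (\<integral>\<^sup>+x. (\<integral>\<^sup>+s. indicator {x. ennreal (s * M) < f x} x * indicator {0<..<1} s \<partial>lborel) \<partial>lborel)"
    by (rule lborel_pair.Fubini') measurable
  also have "\<dots> = (\<integral>\<^sup>+x. f x / ennreal M \<partial>lborel)"
  proof (intro nn_integral_cong)
    fix x
    obtain r where r: "0 \<le> r" "r \<le> M" "f x = ennreal r"
      using le[of x] by (metis ennreal_cases ennreal_le_iff less_imp_le[OF M] ennreal_neq_top top.extremum_uniqueI)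
    have "(\<integral>\<^sup>+s. indicator {x. ennreal (s * M) < f x} x * indicator {0<..<1} s \<partial>lborel) =
        (\<integral>\<^sup>+s. indicator {0<..<r / M} s \<partial>lborel)"
    proof (intro nn_integral_cong)
      fix s :: real
      have "s < 1" if "s < r / M" using that r M by (smt (verit) divide_le_eq_1_pos)
      then have "ennreal (s * M) < f x \<and> s \<in> {0<..<1} \<longleftrightarrow> s \<in> {0<..<r / M}"
        using r M by (auto simp: ennreal_less_iff field_simps)
      then show "indicator {x. ennreal (s * M) < f x} x * indicator {0<..<1} s
          = (indicator {0<..<r / M} s :: ennreal)"
        by (auto simp: indicator_def)
    qed
    also have "\<dots> = f x / ennreal M" using r M by (simp add: divide_ennreal)
    finally show "(\<integral>\<^sup>+s. indicator {x. ennreal (s * M) < f x} x * indicator {0<..<1} s \<partial>lborel) = f x / ennreal M" .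
  qed
  also have "ennreal M * \<dots> = (\<integral>\<^sup>+x. ennreal M * (f x / ennreal M) \<partial>lborel)"
    by (simp add: nn_integral_cmult)
  also have "\<dots> = (\<integral>\<^sup>+x. f x \<partial>lborel)"
    using M by (intro nn_integral_cong) (metis ennreal_mult_divide_eq ennreal_times_divide mult.commute
        ennreal_eq_0_iff ennreal_neq_top linorder_not_le)
  finally show ?thesis by simp
qed

text \<open>\<open>M\<close> is the supremum. Values of \<open>f\<close> approach it, so every
  superlevel set below it is nonempty, as Brunn--Minkowski on the line demands.\<close>

lemma bounded_ennreal_SUP:
  fixes f :: "'a \<Rightarrow> ennreal"
  assumes "\<And>x. f x \<le> of_nat N" "f x0 > 0"
  obtains M where "0 < M" "\<And>x. f x \<le> ennreal M" "\<And>t. t < M \<Longrightarrow> \<exists>x. ennreal t < f x"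
proof -
  have "(SUP x. f x) \<le> ennreal (real N)"
    by (intro SUP_least) (simp add: assms ennreal_of_nat_eq_real_of_nat[symmetric])
  then obtain M where M: "0 \<le> M" "(SUP x. f x) = ennreal M"
    by (metis ennreal_cases ennreal_neq_top top.extremum_uniqueI)
  have *: "f x \<le> ennreal M" for x using M by (metis SUP_upper UNIV_I)
  show ?thesis
  proof (rule that)
    show "0 < M" using assms(2) *[of x0] M by (metis ennreal_less_zero_iff less_le_trans)
    show "\<exists>x. ennreal t < f x" if "t < M" for t
      using that M \<open>0 < M\<close> less_SUP_iff[of "ennreal t" f UNIV] by (simp add: ennreal_lessI)
  qed (rule *)
qed

text \<open>Relative to the suprema, the superlevel sets of \<open>f\<close> and \<open>g\<close> at
  the same height \<open>s\<close> combine into one of \<open>h\<close>, and Brunn--Minkowski on the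
  line adds their lengths. Integrating over \<open>s\<close> bounds the integral of \<open>h\<close>
  from below by a weighted arithmetic mean, which dominates the geometric one.\<close>

lemma prekopa_leindler_real_bounded:
  fixes f g h :: "real \<Rightarrow> ennreal"
  assumes [measurable]: "f \<in> borel_measurable borel" "g \<in> borel_measurable borel" "h \<in> borel_measurable borel"
    and l: "0 < l" "l < 1"
    and fgh: "\<And>x y. geom_le l (f x) (g y) (h ((1 - l) * x + l * y))"
    and bdd: "\<And>x. f x \<le> of_nat N" "\<And>x. g x \<le> of_nat N'"
  shows "geom_le l (\<integral>\<^sup>+x. f x \<partial>lborel) (\<integral>\<^sup>+x. g x \<partial>lborel) (\<integral>\<^sup>+x. h x \<partial>lborel)"
  unfolding geom_le_def
proof (intro allI impI)
  fix a b :: real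
  assume ab: "0 < a" "0 < b" and af: "ennreal a < (\<integral>\<^sup>+x. f x \<partial>lborel)" and bg: "ennreal b < (\<integral>\<^sup>+x. g x \<partial>lborel)"
  have "\<exists>x. f x > 0"
  proof (rule ccontr)
    assume "\<not> ?thesis"
    then have "f = (\<lambda>x. 0)" by (auto simp: not_less)
    with af show False by simp
  qed
  then obtain M where M: "0 < M" "\<And>x. f x \<le> ennreal M" "\<And>t. t < M \<Longrightarrow> \<exists>x. ennreal t < f x"
    using bounded_ennreal_SUP[of f N] bdd(1) by metis
  have "\<exists>x. g x > 0"
  proof (rule ccontr)
    assume "\<not> ?thesis"
    then have "g = (\<lambda>x. 0)" by (auto simp: not_less)
    with bg show False by simp
  qed
  then obtain M' where M': "0 < M'" "\<And>x. g x \<le> ennreal M'" "\<And>t. t < M' \<Longrightarrow> \<exists>x. ennreal t < g x"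
    using bounded_ennreal_SUP[of g N'] bdd(2) by metis
  \<comment> \<open>The geometric mean of the two suprema; \<open>h\<close> may exceed it and is cut
    off there so that the layer cake formula applies.\<close>
  define K where "K = M powr (1 - l) * M' powr l"
  have K: "0 < K" using M M' by (simp add: K_def)
  define I where "I f M = (\<integral>\<^sup>+s. emeasure lborel {x. ennreal (s * M) < f x} * indicator {0<..<1} s \<partial>lborel)"
    for f :: "real \<Rightarrow> ennreal" and M :: real
  have levels: "ennreal (1 - l) * emeasure lborel {x. ennreal (s * M) < f x}
        + ennreal l * emeasure lborel {x. ennreal (s * M') < g x}
      \<le> emeasure lborel {x. ennreal (s * K) < min (h x) (ennreal K)}" if s: "0 < s" "s < 1" for s
  proof (rule brunn_minkowski_real)
    show "{x. ennreal (s * M) < f x} \<noteq> {}" "{x. ennreal (s * M') < g x} \<noteq> {}"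
      using M(3)[of "s * M"] M'(3)[of "s * M'"] M(1) M'(1) s by auto
    fix x y assume "x \<in> {x. ennreal (s * M) < f x}" "y \<in> {x. ennreal (s * M') < g x}"
    \<comment> \<open>\<open>geom_le\<close> speaks only of reals strictly below the two values, so
      \<open>p\<close> and \<open>q\<close> are inserted between the levels and the values.\<close>
    then obtain p q where p: "ennreal (s * M) < ennreal p" "ennreal p < f x"
      and q: "ennreal (s * M') < ennreal q" "ennreal q < g y"
      using ennreal_between_real by (metis mem_Collect_eq)
    have pq: "s * M < p" "s * M' < q" using p q s M M' by (simp_all add: ennreal_less_iff)
    moreover have "0 < s * M" "0 < s * M'" using s M M' by simp_all
    ultimately have "0 < p" "0 < q" by linarith+
    have "s * K = (s * M) powr (1 - l) * (s * M') powr l"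
    proof -
      have "s powr (1 - l) * s powr l = s" using s by (simp flip: powr_add)
      then show ?thesis using s M M' by (simp add: K_def powr_mult algebra_simps)
    qed
    also have "\<dots> < p powr (1 - l) * q powr l"
      using pq l \<open>0 < s * M\<close> \<open>0 < s * M'\<close> by (intro mult_strict_mono powr_less_mono2) auto
    finally have "ennreal (s * K) < ennreal (p powr (1 - l) * q powr l)"
      using K s \<open>0 < p\<close> \<open>0 < q\<close> by (intro ennreal_lessI) simp_all
    also have "\<dots> \<le> h ((1 - l) * x + l * y)"
      using geom_leD[OF fgh \<open>0 < p\<close> \<open>0 < q\<close> p(2) q(2)] .
    finally show "(1 - l) * x + l * y \<in> {x. ennreal (s * K) < min (h x) (ennreal K)}"
      using s K by (simp add: ennreal_less_iff)
  qed (use l in simp_all)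
  have "ennreal (1 - l) * I f M + ennreal l * I g M' =
      (\<integral>\<^sup>+s. (ennreal (1 - l) * emeasure lborel {x. ennreal (s * M) < f x}
        + ennreal l * emeasure lborel {x. ennreal (s * M') < g x}) * indicator {0<..<1} s \<partial>lborel)"
    by (simp add: I_def nn_integral_add nn_integral_cmult distrib_right mult.assoc)
  also have "\<dots> \<le> I (\<lambda>x. min (h x) (ennreal K)) K"
    unfolding I_def by (intro nn_integral_mono) (use levels in \<open>auto split: split_indicator\<close>)
  finally have I: "ennreal (1 - l) * I f M + ennreal l * I g M' \<le> I (\<lambda>x. min (h x) (ennreal K)) K" .
  have scale: "ennreal (a / M) \<le> I f M" if "0 < a" "0 < M" "f \<in> borel_measurable borel" "\<And>x. f x \<le> ennreal M"
     "ennreal a < (\<integral>\<^sup>+x. f x \<partial>lborel)" for a M f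
  proof -
    have "ennreal M * ennreal (a / M) = ennreal a"
      using that(1,2) by (simp flip: ennreal_mult')
    also have "\<dots> \<le> ennreal M * I f M"
      unfolding I_def using that by (simp add: nn_integral_layer_cake[symmetric] less_imp_le)
    finally show ?thesis using that(2) by (simp add: ennreal_mult_le_mult_iff)
  qed
  \<comment> \<open>The weighted inequality of arithmetic and geometric means makes the additive
    bound multiplicative; the factor \<open>K\<close> then undoes the scaling.\<close>
  have "ennreal ((a / M) powr (1 - l) * (b / M') powr l) \<le> ennreal ((1 - l) * (a / M) + l * (b / M'))"
    using ab M M' l by (intro ennreal_leI Youngs_inequality_0) auto
  also have "\<dots> = ennreal (1 - l) * ennreal (a / M) + ennreal l * ennreal (b / M')"
    using l ab M(1) M'(1) by (simp flip: ennreal_mult' ennreal_plus)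
  also have "\<dots> \<le> ennreal (1 - l) * I f M + ennreal l * I g M'"
    using scale[OF ab(1) M(1) _ M(2) af] scale[OF ab(2) M'(1) _ M'(2) bg] by (intro add_mono mult_left_mono) auto
  also note I
  finally have "ennreal K * ennreal ((a / M) powr (1 - l) * (b / M') powr l) \<le> ennreal K * I (\<lambda>x. min (h x) (ennreal K)) K"
    by (rule mult_left_mono) simp
  also have "\<dots> = (\<integral>\<^sup>+x. min (h x) (ennreal K) \<partial>lborel)"
    unfolding I_def using K by (intro nn_integral_layer_cake[symmetric]) auto
  also have "\<dots> \<le> (\<integral>\<^sup>+x. h x \<partial>lborel)" by (intro nn_integral_mono) auto
  also have "ennreal K * ennreal ((a / M) powr (1 - l) * (b / M') powr l) = ennreal (a powr (1 - l) * b powr l)"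
    using K M M' ab by (simp add: K_def powr_divide flip: ennreal_mult')
  finally show "ennreal (a powr (1 - l) * b powr l) \<le> (\<integral>\<^sup>+x. h x \<partial>lborel)" .
qed

text \<open>\<open>geom_le\<close> tests only numbers strictly below the integrals, and by monotone
  convergence these already lie below the integrals of bounded truncations.\<close>

lemma prekopa_leindler_real:
  fixes f g h :: "real \<Rightarrow> ennreal"
  assumes [measurable]: "f \<in> borel_measurable borel" "g \<in> borel_measurable borel" "h \<in> borel_measurable borel"
    and l: "0 < l" "l < 1"
    and fgh: "\<And>x y. geom_le l (f x) (g y) (h ((1 - l) * x + l * y))"
  shows "geom_le l (\<integral>\<^sup>+x. f x \<partial>lborel) (\<integral>\<^sup>+x. g x \<partial>lborel) (\<integral>\<^sup>+x. h x \<partial>lborel)"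
  unfolding geom_le_def
proof (intro allI impI)
  have truncate: "\<exists>n::nat. p < (\<integral>\<^sup>+x. min (f x) (of_nat n) \<partial>lborel)"
    if [measurable]: "f \<in> borel_measurable borel" and p: "p < (\<integral>\<^sup>+x. f x \<partial>lborel)"
    for f :: "real \<Rightarrow> ennreal" and p
  proof -
    have "f x = (SUP n::nat. min (f x) (of_nat n))" for x
      using inf_SUP[of "f x" "of_nat :: nat \<Rightarrow> ennreal" UNIV] ennreal_SUP_of_nat_eq_top by (simp add: inf_min)
    then have "(\<integral>\<^sup>+x. f x \<partial>lborel) = (\<integral>\<^sup>+x. (SUP n::nat. min (f x) (of_nat n)) \<partial>lborel)"
      by (intro nn_integral_cong)
    also have "\<dots> = (SUP n::nat. \<integral>\<^sup>+x. min (f x) (of_nat n) \<partial>lborel)"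
      by (rule nn_integral_monotone_convergence_SUP)
        (auto simp: incseq_def le_fun_def intro: min.coboundedI2 of_nat_mono)
    finally show ?thesis using p by (simp add: less_SUP_iff)
  qed
  fix a b :: real
  assume ab: "0 < a" "0 < b" and af: "ennreal a < (\<integral>\<^sup>+x. f x \<partial>lborel)" and bg: "ennreal b < (\<integral>\<^sup>+x. g x \<partial>lborel)"
  obtain n :: nat where n: "ennreal a < (\<integral>\<^sup>+x. min (f x) (of_nat n) \<partial>lborel)"
    using truncate[OF _ af] by auto
  obtain m :: nat where m: "ennreal b < (\<integral>\<^sup>+x. min (g x) (of_nat m) \<partial>lborel)"
    using truncate[OF _ bg] by auto
  have "geom_le l (\<integral>\<^sup>+x. min (f x) (of_nat n) \<partial>lborel) (\<integral>\<^sup>+x. min (g x) (of_nat m) \<partial>lborel) (\<integral>\<^sup>+x. h x \<partial>lborel)"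
    by (rule prekopa_leindler_real_bounded[where N = n and N' = m]) (use l in \<open>auto intro: geom_le_mono[OF fgh]\<close>)
  then show "ennreal (a powr (1 - l) * b powr l) \<le> (\<integral>\<^sup>+x. h x \<partial>lborel)"
    using ab n m by (rule geom_leD)
qed

text \<open>Induction on the number of directions: for fixed heights \<open>s\<close>,
  \<open>t\<close> along \<open>u\<close> the induction hypothesis compares the slice integrals,
  which then satisfy the hypothesis of the inequality on the line.\<close>

theorem prekopa_leindler:
  fixes f g h :: "'a::euclidean_space \<Rightarrow> ennreal"
  assumes "finite B" and l: "0 < l" "l < 1"
    and "f \<in> borel_measurable borel" "g \<in> borel_measurable borel" "h \<in> borel_measurable borel"
    and "\<And>x y. geom_le l (f x) (g y) (h ((1 - l) *\<^sub>R x + l *\<^sub>R y))"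
  shows "geom_le l (\<integral>\<^sup>+x. f x \<partial>span_lborel B) (\<integral>\<^sup>+x. g x \<partial>span_lborel B) (\<integral>\<^sup>+x. h x \<partial>span_lborel B)"
  using assms(1,4-)
proof (induction B arbitrary: f g h rule: finite_induct)
  case empty
  have "geom_le l (f 0) (g 0) (h 0)" using empty.prems(4)[of 0 0] by simp
  with empty.prems show ?case by (simp add: nn_integral_span_lborel_empty)
next
  case (insert u B)
  note [measurable] = insert.prems(1-3)
  have meas: "(\<lambda>t. \<integral>\<^sup>+x. f (x + t *\<^sub>R u) \<partial>span_lborel B) \<in> borel_measurable borel"
    if [measurable]: "f \<in> borel_measurable borel" for f
    by (rule borel_measurable_nn_integral_span_lborel) (use insert.hyps in simp_all)
  have "geom_le l (\<integral>\<^sup>+t. (\<integral>\<^sup>+x. f (x + t *\<^sub>R u) \<partial>span_lborel B) \<partial>lborel)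
      (\<integral>\<^sup>+t. (\<integral>\<^sup>+x. g (x + t *\<^sub>R u) \<partial>span_lborel B) \<partial>lborel)
      (\<integral>\<^sup>+t. (\<integral>\<^sup>+x. h (x + t *\<^sub>R u) \<partial>span_lborel B) \<partial>lborel)"
  proof (rule prekopa_leindler_real[OF meas meas meas l])
    fix s t :: real
    show "geom_le l (\<integral>\<^sup>+x. f (x + s *\<^sub>R u) \<partial>span_lborel B) (\<integral>\<^sup>+x. g (x + t *\<^sub>R u) \<partial>span_lborel B)
        (\<integral>\<^sup>+x. h (x + ((1 - l) * s + l * t) *\<^sub>R u) \<partial>span_lborel B)"
    proof (rule insert.IH)
      fix x y
      show "geom_le l (f (x + s *\<^sub>R u)) (g (y + t *\<^sub>R u))
          (h ((1 - l) *\<^sub>R x + l *\<^sub>R y + ((1 - l) * s + l * t) *\<^sub>R u))"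
        using insert.prems(4)[of "x + s *\<^sub>R u" "y + t *\<^sub>R u"] by (simp add: algebra_simps)
    qed simp_all
  qed (use insert.prems in auto)
  with insert.hyps show ?case by (simp add: nn_integral_span_lborel_insert)
qed

corollary prekopa_leindler_sets:
  fixes S T U :: "'a::euclidean_space set"
  assumes "finite B" and l: "0 < l" "l < 1"
    and [measurable]: "S \<in> sets borel" "T \<in> sets borel" "U \<in> sets borel"
    and sub: "\<And>x y. x \<in> S \<Longrightarrow> y \<in> T \<Longrightarrow> (1 - l) *\<^sub>R x + l *\<^sub>R y \<in> U"
  shows "geom_le l (emeasure (span_lborel B) S) (emeasure (span_lborel B) T) (emeasure (span_lborel B) U)"
proof -
  \<comment> \<open>For indicators the hypothesis concerns only \<open>x\<close> in
    \<open>S\<close>, \<open>y\<close> in \<open>T\<close> and \<open>a\<close>, \<open>b\<close>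
    below 1, where the geometric mean is at most 1.\<close>
  have le1: "a powr (1 - l) * b powr l \<le> 1" if "0 < a" "0 < b" "a < 1" "b < 1" for a b :: real
    using that l by (intro mult_le_one powr_le1) auto
  have "geom_le l (\<integral>\<^sup>+x. indicator S x \<partial>span_lborel B) (\<integral>\<^sup>+x. indicator T x \<partial>span_lborel B)
      (\<integral>\<^sup>+x. indicator U x \<partial>span_lborel B)"
    by (rule prekopa_leindler[OF \<open>finite B\<close> l])
      (use sub le1 in \<open>auto simp: geom_le_def indicator_def\<close>)
  then show ?thesis by simp
qed

section \<open>Brunn--Minkowski for roots of volumes\<close>

lemma emeasure_lborel_affine_vimage:
  fixes A :: "'a::euclidean_space set"
  assumes [measurable]: "A \<in> sets borel" and "0 < c"
  shows "ennreal (c ^ DIM('a)) * emeasure lborel {x. t + c *\<^sub>R x \<in> A} = emeasure lborel A"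
proof -
  have "emeasure lborel A =
      emeasure (density (distr lborel borel (\<lambda>x. t + c *\<^sub>R x)) (\<lambda>_. \<bar>c\<bar> ^ DIM('a))) A"
    using \<open>0 < c\<close> by (subst lborel_affine[of c t]) simp_all
  also have "\<dots> = ennreal (c ^ DIM('a)) * emeasure lborel {x. t + c *\<^sub>R x \<in> A}"
    using \<open>0 < c\<close> by (simp add: emeasure_density_const emeasure_distr vimage_def)
  finally show ?thesis ..
qed

(* Rescaling S and T to volume 1 turns the multiplicative form of the inequality, with the
   parameter m = l t / ((1 - l) s + l t), into the concavity of the DIM('a)-th root of the volume. *)
lemma brunn_minkowski_powers:
  fixes S T U :: "'a::euclidean_space set"
  assumes [measurable]: "S \<in> sets borel" "T \<in> sets borel" "U \<in> sets borel"
    and l: "0 < l" "l < 1"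
    and sub: "\<And>x y. x \<in> S \<Longrightarrow> y \<in> T \<Longrightarrow> (1 - l) *\<^sub>R x + l *\<^sub>R y \<in> U"
    and st: "0 < s" "0 < t"
    and vol: "emeasure lborel S = ennreal (s ^ DIM('a))" "emeasure lborel T = ennreal (t ^ DIM('a))"
  shows "ennreal (((1 - l) * s + l * t) ^ DIM('a)) \<le> emeasure lborel U"
proof -
  define r where "r = (1 - l) * s + l * t"
  have r: "0 < r" using l st by (simp add: r_def add_pos_pos)
  define m where "m = l * t / r"
  have m: "r * m = l * t" "r * (1 - m) = (1 - l) * s" "0 < m" "m < 1"
    using r l st by (simp_all add: m_def algebra_simps) (simp_all add: r_def algebra_simps)
  have one: "emeasure lborel {x. 0 + c *\<^sub>R x \<in> A} = 1"
    if "A \<in> sets borel" "0 < c" "emeasure lborel A = ennreal (c ^ DIM('a))" for A :: "'a set" and c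
    using emeasure_lborel_affine_vimage[OF that(1,2), of 0] that(2,3)
    by (metis ennreal_eq_0_iff ennreal_mult_cancel_left ennreal_neq_top linorder_not_le mult.right_neutral
        zero_less_power)
  have "geom_le m (emeasure (span_lborel Basis) {x. 0 + s *\<^sub>R x \<in> S})
      (emeasure (span_lborel Basis) {x. 0 + t *\<^sub>R x \<in> T}) (emeasure (span_lborel Basis) {x. 0 + r *\<^sub>R x \<in> U})"
  proof (rule prekopa_leindler_sets)
    fix x y assume "x \<in> {x. 0 + s *\<^sub>R x \<in> S}" "y \<in> {x. 0 + t *\<^sub>R x \<in> T}"
    then have "(1 - l) *\<^sub>R s *\<^sub>R x + l *\<^sub>R t *\<^sub>R y \<in> U"
      by (intro sub) simp_all
    also have "(1 - l) *\<^sub>R s *\<^sub>R x + l *\<^sub>R t *\<^sub>R y = r *\<^sub>R ((1 - m) *\<^sub>R x + m *\<^sub>R y)"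
      by (simp add: m scaleR_add_right)
    finally show "(1 - m) *\<^sub>R x + m *\<^sub>R y \<in> {x. 0 + r *\<^sub>R x \<in> U}" by simp
  qed (use m in simp_all)
  then have gl: "geom_le m 1 1 (emeasure lborel {x. 0 + r *\<^sub>R x \<in> U})"
    using one[OF assms(1) st(1) vol(1)] one[OF assms(2) st(2) vol(2)] by (simp add: span_lborel_Basis)
  \<comment> \<open>\<open>geom_le\<close> covers only numbers strictly below 1, so the value 1
    itself is reached by density.\<close>
  have "1 \<le> emeasure lborel {x. 0 + r *\<^sub>R x \<in> U}"
  proof (rule dense_le)
    fix p :: ennreal assume "p < 1"
    then obtain a where a: "p < ennreal a" "ennreal a < 1" by (rule ennreal_between_real)
    then have "0 < a" by (metis ennreal_eq_0_iff not_less_zero linorder_not_le)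
    then have "ennreal (a powr (1 - m) * a powr m) \<le> emeasure lborel {x. 0 + r *\<^sub>R x \<in> U}"
      using a by (intro geom_leD[OF gl])
    also have "a powr (1 - m) * a powr m = a" using \<open>0 < a\<close> by (simp flip: powr_add)
    finally show "p \<le> emeasure lborel {x. 0 + r *\<^sub>R x \<in> U}" using a by simp
  qed
  then have "ennreal (r ^ DIM('a)) * 1 \<le> ennreal (r ^ DIM('a)) * emeasure lborel {x. 0 + r *\<^sub>R x \<in> U}"
    by (rule mult_left_mono) simp
  then show ?thesis
    using emeasure_lborel_affine_vimage[OF assms(3) r, of 0] by (simp add: r_def)
qed

subsection \<open>Convex bodies and their covariogram\<close>

text \<open>This is \<open>K \<inter> (K + x)\<close>; the condition on \<open>y - x\<close> turns
  translates into substitutions in integrals.\<close>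

definition shifted_inter :: "'a::euclidean_space set \<Rightarrow> 'a \<Rightarrow> 'a set" where
  "shifted_inter K x = {y \<in> K. y - x \<in> K}"

definition covariogram :: "'a::euclidean_space set \<Rightarrow> 'a \<Rightarrow> real" where
  "covariogram K x = measure lborel (shifted_inter K x)"

locale body =
  fixes K :: "'a::euclidean_space set"
  assumes body: "convex_body K"
begin

abbreviation "V \<equiv> measure lborel K"

lemma compact_K: "compact K" and convex_K: "convex K" and interior_K: "interior K \<noteq> {}"
  using body by (auto simp: convex_body_def)

lemma sets_K [measurable]: "K \<in> sets borel"
  using compact_K by (rule borel_compact)

lemma sets_shifted_inter [measurable]: "shifted_inter K x \<in> sets borel"
  unfolding shifted_inter_def by measurable

lemma emeasure_K: "emeasure lborel K = ennreal V"
  using emeasure_compact_finite[OF compact_K] by (simp add: emeasure_eq_ennreal_measure)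

lemma emeasure_shifted_inter: "emeasure lborel (shifted_inter K x) = ennreal (covariogram K x)"
proof -
  have "emeasure lborel (shifted_inter K x) \<le> emeasure lborel K"
    by (intro emeasure_mono) (auto simp: shifted_inter_def)
  then have "emeasure lborel (shifted_inter K x) \<noteq> \<infinity>"
    using emeasure_K by (auto simp: top_unique)
  then show ?thesis by (simp add: covariogram_def emeasure_eq_ennreal_measure)
qed

lemma emeasure_shifted_inter_integral:
  "emeasure lborel (shifted_inter K x) = (\<integral>\<^sup>+y. indicator K y * indicator K (y - x) \<partial>lborel)"
proof -
  have "emeasure lborel (shifted_inter K x) = (\<integral>\<^sup>+y. indicator (shifted_inter K x) y \<partial>lborel)"
    by simp
  also have "\<dots> = (\<integral>\<^sup>+y. indicator K y * indicator K (y - x) \<partial>lborel)"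
    by (intro nn_integral_cong) (simp add: shifted_inter_def indicator_def)
  finally show ?thesis .
qed

lemma covariogram_nonneg: "0 \<le> covariogram K x"
  by (simp add: covariogram_def)

lemma covariogram_le: "covariogram K x \<le> V"
  unfolding covariogram_def
  by (rule measure_mono_fmeasurable) (auto simp: shifted_inter_def fmeasurable_compact[OF compact_K])

lemma inner_ball:
  obtains c r where "0 < r" "cball c r \<subseteq> K"
  using interior_K by (metis ex_in_conv mem_interior_cball)

lemma V_pos: "0 < V"
proof -
  obtain c r where r: "0 < r" "cball c r \<subseteq> K" by (rule inner_ball)
  have "0 < emeasure lborel (ball c r)"
    using r by (simp add: emeasure_ball ennreal_zero_less_mult_iff)
  also have "\<dots> \<le> emeasure lborel K"
    using r ball_subset_cball by (intro emeasure_mono) auto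
  finally show ?thesis by (simp add: emeasure_K)
qed

text \<open>As \<open>K\<close> is convex, convex combinations of the intersections for
  \<open>x\<close> and \<open>y\<close> lie in the intersection for the combined shift. The
  geometric mean of two volumes above \<open>a\<close> is at least \<open>a\<close>.\<close>

lemma covariogram_superlevel_convex:
  assumes "0 \<le> s"
  shows "convex {x. s < covariogram K x}"
proof (rule convexI)
  fix x y and u v :: real
  assume xy: "x \<in> {x. s < covariogram K x}" "y \<in> {x. s < covariogram K x}" and uv: "0 \<le> u" "0 \<le> v" "u + v = 1"
  show "u *\<^sub>R x + v *\<^sub>R y \<in> {x. s < covariogram K x}"
  proof (cases "u = 0 \<or> v = 0")
    case True
    then show ?thesis using xy uv by auto
  next
    case False
    then have v: "0 < v" "v < 1" and u: "u = 1 - v" using uv by auto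
    let ?z = "(1 - v) *\<^sub>R x + v *\<^sub>R y"
    \<comment> \<open>Strict on both sides: below the two volumes as \<open>geom_le\<close>
      requires, and above \<open>s\<close> to keep the conclusion strict.\<close>
    obtain a where a: "s < a" "a < covariogram K x" "a < covariogram K y"
      using xy dense[of s "min (covariogram K x) (covariogram K y)"] by auto
    have "geom_le v (emeasure (span_lborel Basis) (shifted_inter K x))
        (emeasure (span_lborel Basis) (shifted_inter K y)) (emeasure (span_lborel Basis) (shifted_inter K ?z))"
    proof (rule prekopa_leindler_sets)
      fix p q assume pq: "p \<in> shifted_inter K x" "q \<in> shifted_inter K y"
      have "(1 - v) *\<^sub>R p + v *\<^sub>R q \<in> K" "(1 - v) *\<^sub>R (p - x) + v *\<^sub>R (q - y) \<in> K"
        using pq v convexD[OF convex_K] by (auto simp: shifted_inter_def)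
      then show "(1 - v) *\<^sub>R p + v *\<^sub>R q \<in> shifted_inter K ?z"
        by (simp add: shifted_inter_def algebra_simps)
    qed (use v in simp_all)
    then have "ennreal (a powr (1 - v) * a powr v) \<le> ennreal (covariogram K ?z)"
      using a \<open>0 \<le> s\<close> by (intro geom_leD) (auto simp: span_lborel_Basis emeasure_shifted_inter ennreal_less_iff)
    also have "a powr (1 - v) * a powr v = a" using a \<open>0 \<le> s\<close> by (simp flip: powr_add)
    finally have "a \<le> covariogram K ?z" by (simp add: covariogram_nonneg)
    with a u show ?thesis by simp
  qed
qed

lemma covariogram_uminus: "covariogram K (- x) = covariogram K x"
proof -
  have "emeasure lborel (shifted_inter K (- x)) = (\<integral>\<^sup>+y. indicator K y * indicator K (x + y) \<partial>lborel)"
    by (simp add: emeasure_shifted_inter_integral add.commute)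
  also have "\<dots> = (\<integral>\<^sup>+y. indicator K (- x + (x + y)) * indicator K (x + y) \<partial>lborel)"
    by simp
  also have "\<dots> = (\<integral>\<^sup>+y. indicator K (- x + y) * indicator K y \<partial>lborel)"
    by (rule nn_integral_lborel_shift) measurable
  also have "\<dots> = emeasure lborel (shifted_inter K x)"
    by (simp add: emeasure_shifted_inter_integral mult.commute)
  finally show ?thesis by (simp add: emeasure_shifted_inter covariogram_nonneg)
qed

lemma covariogram_measurable [measurable]: "covariogram K \<in> borel_measurable borel"
proof -
  have "covariogram K x = enn2real (\<integral>\<^sup>+y. indicator K y * indicator K (y - x) \<partial>lborel)" for x
    by (metis covariogram_nonneg emeasure_shifted_inter emeasure_shifted_inter_integral enn2real_ennreal)
  then show ?thesis by (simp cong: measurable_cong)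
qed

text \<open>By Tonelli, each \<open>y\<close> in \<open>K\<close> contributes the volume of its
  admissible shifts \<open>x\<close>, which form a reflected translate of \<open>K\<close>.\<close>

lemma nn_integral_covariogram: "(\<integral>\<^sup>+x. ennreal (covariogram K x) \<partial>lborel) = ennreal (V\<^sup>2)"
proof -
  have "(\<integral>\<^sup>+x. ennreal (covariogram K x) \<partial>lborel) =
      (\<integral>\<^sup>+x. (\<integral>\<^sup>+y. indicator K y * indicator K (y - x) \<partial>lborel) \<partial>lborel)"
    by (simp flip: emeasure_shifted_inter add: emeasure_shifted_inter_integral)
  also have "\<dots> = (\<integral>\<^sup>+y. (\<integral>\<^sup>+x. indicator K y * indicator K (y - x) \<partial>lborel) \<partial>lborel)"
    by (rule lborel_pair.Fubini') measurable
  also have "\<dots> = (\<integral>\<^sup>+y. indicator K y * emeasure lborel K \<partial>lborel)"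
  proof (intro nn_integral_cong)
    fix y
    have "(\<integral>\<^sup>+x. indicator K (y - x) \<partial>lborel) = (\<integral>\<^sup>+x. indicator K (y + x) \<partial>lborel)"
      by (subst nn_integral_lborel_uminus[symmetric]) simp_all
    also have "\<dots> = emeasure lborel K"
      by (subst nn_integral_lborel_shift) simp_all
    finally show "(\<integral>\<^sup>+x. indicator K y * indicator K (y - x) \<partial>lborel) = indicator K y * emeasure lborel K"
      by (simp add: nn_integral_cmult)
  qed
  also have "\<dots> = ennreal (V\<^sup>2)"
    by (simp add: nn_integral_multc emeasure_K power2_eq_square ennreal_mult')
  finally show ?thesis .
qed

section \<open>The decrease of the covariogram along a ray\<close>

lemma emeasure_proj_contraction:
  assumes u: "norm u = 1" and e: "0 < e" "e < 1"
  shows "ennreal ((1 - e) ^ DIM('a) * proj_volume K u)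
    \<le> emeasure (subspace_lborel ({u}\<^sup>\<bottom>)) (hyperplane_proj u ` (\<lambda>x. e *\<^sub>R c + (1 - e) *\<^sub>R x) ` K)"
proof -
  let ?K' = "(\<lambda>x. e *\<^sub>R c + (1 - e) *\<^sub>R x) ` K"
  let ?P = "hyperplane_proj u ` K" and ?P' = "hyperplane_proj u ` ?K'"
  let ?C = "\<lambda>P. {x. hyperplane_proj u x \<in> P \<and> x \<bullet> u \<in> {0..1}}"
  have "compact ?K'" by (intro compact_continuous_image compact_K continuous_intros)
  then have [measurable]: "?P' \<in> sets borel" "?P \<in> sets borel"
    using compact_K u by (auto intro!: borel_compact compact_hyperplane_proj)
  have [measurable]: "hyperplane_proj u \<in> borel_measurable borel"
    using u by (intro borel_measurable_continuous_onI continuous_hyperplane_proj)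
  have C [measurable]: "?C ?P \<in> sets borel" "?C ?P' \<in> sets borel" by measurable
  interpret hp: linear "hyperplane_proj u" by (rule linear_hyperplane_proj)
  let ?v = "e *\<^sub>R hyperplane_proj u c"
  \<comment> \<open>The map shrinks the unit cylinder over the projection into the one over the
    contracted projection. Its height shrinks too, which costs one factor \<open>1 - e\<close> more
    than the dimension of the hyperplane; this disappears as \<open>e\<close> tends to 0.\<close>
  have "?C ?P \<subseteq> {x. ?v + (1 - e) *\<^sub>R x \<in> ?C ?P'}"
  proof
    fix x assume x: "x \<in> ?C ?P"
    then obtain k where k: "k \<in> K" "hyperplane_proj u x = hyperplane_proj u k" by auto
    have ort: "hyperplane_proj u c \<bullet> u = 0"
      using hyperplane_proj_in[OF u, of c] by (simp add: orthogonal_comp_def orthogonal_def inner_commute)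
    have "hyperplane_proj u (hyperplane_proj u c) = hyperplane_proj u c"
      by (simp add: hyperplane_proj_eq[OF u, of "hyperplane_proj u c"] ort)
    then have "hyperplane_proj u (?v + (1 - e) *\<^sub>R x) = hyperplane_proj u (e *\<^sub>R c + (1 - e) *\<^sub>R k)"
      by (simp add: hp.add hp.scale k)
    moreover have "(?v + (1 - e) *\<^sub>R x) \<bullet> u \<in> {0..1}"
      using x e by (auto simp: inner_add_left ort intro: mult_le_one)
    ultimately show "x \<in> {x. ?v + (1 - e) *\<^sub>R x \<in> ?C ?P'}"
      using k by auto
  qed
  then have "ennreal ((1 - e) ^ DIM('a)) * emeasure lborel (?C ?P)
      \<le> ennreal ((1 - e) ^ DIM('a)) * emeasure lborel {x. ?v + (1 - e) *\<^sub>R x \<in> ?C ?P'}"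
    by (intro mult_left_mono emeasure_mono) auto
  also have "\<dots> = emeasure lborel (?C ?P')"
    using e by (intro emeasure_lborel_affine_vimage C) simp
  finally show ?thesis
    using e emeasure_lborel_cylinder[OF u, of ?P 0 1] emeasure_lborel_cylinder[OF u, of ?P' 0 1]
    by (simp add: emeasure_hyperplane_proj[OF compact_K u] ennreal_mult')
qed

text \<open>A point of the contracted body keeps a ball of radius \<open>e * r\<close> inside
  \<open>K\<close>, so the line over \<open>x\<close> meets \<open>K\<close> in a chord of length at
  least \<open>2 * e * r\<close>. With \<open>a\<close> the start of that chord, its first stretch
  of length \<open>t\<close> lies in \<open>K\<close>, and the shift by \<open>- t\<close> takes
  this stretch in front of the chord.\<close>

lemma chord_start:
  assumes u: "norm u = 1" and e: "0 < e" "e < 1" and c: "cball c r \<subseteq> K" and t: "0 < t" "t \<le> 2 * e * r"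
    and x: "x \<in> hyperplane_proj u ` (\<lambda>x. e *\<^sub>R c + (1 - e) *\<^sub>R x) ` K"
  obtains a where "\<And>s. s \<in> {a..<a + t} \<Longrightarrow> x + s *\<^sub>R u \<in> K \<and> x + (s - t) *\<^sub>R u \<notin> K"
proof -
  obtain k where k: "k \<in> K" "x = hyperplane_proj u (e *\<^sub>R c + (1 - e) *\<^sub>R k)" using x by auto
  define k' where "k' = e *\<^sub>R c + (1 - e) *\<^sub>R k"
  define b where "b = k' \<bullet> u"
  have x_perp: "x \<in> {u}\<^sup>\<bottom>" using k hyperplane_proj_in[OF u] by simp
  have k': "k' = x + b *\<^sub>R u" using k by (simp add: hyperplane_proj_eq[OF u] k'_def b_def)
  have near: "x + (b + d) *\<^sub>R u \<in> K" if "\<bar>d\<bar> \<le> e * r" for d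
  proof -
    \<comment> \<open>\<open>k'\<close> has weight \<open>e\<close> on \<open>c\<close>, so moving
      \<open>c\<close> by \<open>d / e\<close> moves \<open>k'\<close> by \<open>d\<close>.\<close>
    have "c + (d / e) *\<^sub>R u \<in> cball c r"
      using that e u by (simp add: dist_norm field_simps)
    then have "e *\<^sub>R (c + (d / e) *\<^sub>R u) + (1 - e) *\<^sub>R k \<in> K"
      using c k e by (intro convexD[OF convex_K]) auto
    also have "e *\<^sub>R (c + (d / e) *\<^sub>R u) + (1 - e) *\<^sub>R k = k' + d *\<^sub>R u"
      using e by (simp add: k'_def algebra_simps)
    finally show ?thesis by (simp add: k' algebra_simps)
  qed
  define Y where "Y = K \<inter> {y. hyperplane_proj u y = x}"
  have "compact Y"
    unfolding Y_def using u
    by (intro compact_Int_closed compact_K closed_Collect_eq continuous_hyperplane_proj continuous_on_const)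
  have inY: "x + s *\<^sub>R u \<in> Y \<longleftrightarrow> x + s *\<^sub>R u \<in> K" for s
    by (simp add: Y_def hyperplane_proj_add[OF u x_perp])
  have er: "0 \<le> e * r" using t by simp
  then have left: "x + (b - e * r) *\<^sub>R u \<in> Y"
    using near[of "- (e * r)"] by (simp add: inY)
  have right: "x + (b + e * r) *\<^sub>R u \<in> K"
    using near[of "e * r"] er by simp
  from left \<open>compact Y\<close> obtain y where y: "y \<in> Y" "\<And>z. z \<in> Y \<Longrightarrow> y \<bullet> u \<le> z \<bullet> u"
    using continuous_attains_inf[of Y "\<lambda>z. z \<bullet> u"] continuous_on_inner[OF continuous_on_id continuous_on_const]
    by (metis empty_iff)
  define a where "a = y \<bullet> u"
  have y_eq: "y = x + a *\<^sub>R u"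
    using y(1) by (auto simp: Y_def hyperplane_proj_eq[OF u] a_def)
  have first: "a \<le> s" if "x + s *\<^sub>R u \<in> K" for s
    using y(2)[of "x + s *\<^sub>R u"] that by (simp add: inY a_def hyperplane_proj_add[OF u x_perp])
  show thesis
  proof (rule that)
    fix s assume s: "s \<in> {a..<a + t}"
    have "x + (s - t) *\<^sub>R u \<notin> K" using first[of "s - t"] s by auto
    moreover have "x + s *\<^sub>R u \<in> K"
    proof -
      have "a \<le> b - e * r" using first left inY by blast
      then have sb: "s \<le> b + e * r" "a \<le> s" "a < b + e * r" using s t by auto
      \<comment> \<open>The position of \<open>s\<close> on the segment from \<open>a\<close> to the
        known point \<open>b + e * r\<close> of the chord.\<close>
      define m where "m = (s - a) / (b + e * r - a)"
      have m: "0 \<le> m" "m \<le> 1" "m * (b + e * r - a) = s - a" using sb by (simp_all add: m_def)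
      have "(1 - m) *\<^sub>R (x + a *\<^sub>R u) + m *\<^sub>R (x + (b + e * r) *\<^sub>R u) \<in> K"
        using y right m by (intro convexD[OF convex_K]) (auto simp: y_eq Y_def)
      also have "(1 - m) *\<^sub>R (x + a *\<^sub>R u) + m *\<^sub>R (x + (b + e * r) *\<^sub>R u) = x + (a + m * (b + e * r - a)) *\<^sub>R u"
        by (simp add: algebra_simps)
      finally show ?thesis by (simp add: m)
    qed
    ultimately show "x + s *\<^sub>R u \<in> K \<and> x + (s - t) *\<^sub>R u \<notin> K" by simp
  qed
qed

(* The contraction of K towards c has chords of K of length at least 2 e r over its whole
   projection, so translating K by t uncovers length t over each of these points. *)
lemma covariogram_drop:
  assumes u: "norm u = 1" and e: "0 < e" "e < 1" and c: "cball c r \<subseteq> K" and t: "0 < t" "t \<le> 2 * e * r"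
  shows "covariogram K (t *\<^sub>R u) + t * ((1 - e) ^ DIM('a) * proj_volume K u) \<le> V"
proof -
  let ?S = "shifted_inter K (t *\<^sub>R u)"
  let ?P = "hyperplane_proj u ` (\<lambda>x. e *\<^sub>R c + (1 - e) *\<^sub>R x) ` K"
  have "compact ((\<lambda>x. e *\<^sub>R c + (1 - e) *\<^sub>R x) ` K)"
    by (intro compact_continuous_image compact_K continuous_intros)
  then have [measurable]: "?P \<in> sets borel"
    using u by (intro borel_compact compact_hyperplane_proj)
  have "ennreal (t * ((1 - e) ^ DIM('a) * proj_volume K u)) = ennreal t * ennreal ((1 - e) ^ DIM('a) * proj_volume K u)"
    using t by (simp add: ennreal_mult')
  also have "\<dots> \<le> ennreal t * emeasure (subspace_lborel ({u}\<^sup>\<bottom>)) ?P"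
    by (intro mult_left_mono emeasure_proj_contraction u e) simp
  also have "\<dots> = (\<integral>\<^sup>+x. ennreal t * indicator ?P x \<partial>subspace_lborel ({u}\<^sup>\<bottom>))"
    by (simp add: nn_integral_cmult)
  also have "\<dots> \<le> (\<integral>\<^sup>+x. (\<integral>\<^sup>+s. indicator (K - ?S) (x + s *\<^sub>R u) \<partial>lborel) \<partial>subspace_lborel ({u}\<^sup>\<bottom>))"
  proof (intro nn_integral_mono)
    fix x
    show "ennreal t * indicator ?P x \<le> (\<integral>\<^sup>+s. indicator (K - ?S) (x + s *\<^sub>R u) \<partial>lborel)"
    proof (cases "x \<in> ?P")
      case True
      then obtain a where a: "\<And>s. s \<in> {a..<a + t} \<Longrightarrow> x + s *\<^sub>R u \<in> K \<and> x + (s - t) *\<^sub>R u \<notin> K"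
        using chord_start[OF u e c t] by blast
      have "ennreal t * indicator ?P x = (\<integral>\<^sup>+s. indicator {a..<a + t} s \<partial>lborel)"
        using True t by simp
      also have "\<dots> \<le> (\<integral>\<^sup>+s. indicator (K - ?S) (x + s *\<^sub>R u) \<partial>lborel)"
        using a by (intro nn_integral_mono) (auto simp: indicator_def shifted_inter_def algebra_simps)
      finally show ?thesis .
    qed simp
  qed
  also have "\<dots> = emeasure lborel (K - ?S)"
    using nn_integral_lborel_hyperplane[of "indicator (K - ?S)" u] u by simp
  finally have "ennreal (t * ((1 - e) ^ DIM('a) * proj_volume K u)) \<le> emeasure lborel (K - ?S)" .
  moreover have "emeasure lborel ?S + emeasure lborel (K - ?S) = ennreal V"
    by (subst plus_emeasure) (auto simp: shifted_inter_def emeasure_K[symmetric] intro!: arg_cong[where f = "emeasure lborel"])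
  ultimately have "ennreal (covariogram K (t *\<^sub>R u)) + ennreal (t * ((1 - e) ^ DIM('a) * proj_volume K u)) \<le> ennreal V"
    by (metis add_left_mono emeasure_shifted_inter)
  moreover have "0 \<le> proj_volume K u" by (simp add: proj_volume_def)
  ultimately show ?thesis
    using t e by (simp add: covariogram_nonneg flip: ennreal_plus)
qed

text \<open>By Brunn--Minkowski the root of the covariogram lies above its chord between 0 and
  \<open>T\<close> on the ray, while \<open>covariogram_drop\<close> makes the covariogram fall near
  0 at almost the rate \<open>proj_volume K u\<close> or faster. Comparing the two at a small
  \<open>t\<close> bounds \<open>T\<close>.\<close>

lemma covariogram_bound:
  assumes u: "norm u = 1" and T: "0 < T" and s: "0 \<le> s" "s < covariogram K (T *\<^sub>R u)"
  shows "T * proj_volume K u \<le> DIM('a) * V * (1 - root DIM('a) (s / V))"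
proof -
  let ?n = "DIM('a)"
  have n: "0 < ?n" by simp
  define f0 where "f0 = root ?n V"
  define f1 where "f1 = root ?n (covariogram K (T *\<^sub>R u))"
  have gpos: "0 < covariogram K (T *\<^sub>R u)" using s by simp
  have f0: "0 < f0" "f0 ^ ?n = V" using V_pos by (simp_all add: f0_def)
  have f0_power: "f0 ^ ?n = f0 * f0 ^ (?n - 1)" by (simp add: power_eq_if)
  have f1: "0 < f1" "f1 ^ ?n = covariogram K (T *\<^sub>R u)" using gpos by (simp_all add: f1_def)
  have f10: "f1 \<le> f0" by (simp add: f0_def f1_def covariogram_le)
  obtain c r where r: "0 < r" "cball c r \<subseteq> K" by (rule inner_ball)
  have main: "(1 - e) ^ ?n * (T * proj_volume K u) \<le> ?n * f0 ^ (?n - 1) * (f0 - f1)" if e: "0 < e" "e < 1" for e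
  proof -
    \<comment> \<open>Small enough for \<open>covariogram_drop\<close>, and strictly before
      \<open>T\<close> so that \<open>l\<close> is less than 1.\<close>
    define t where "t = min (T / 2) (2 * e * r)"
    have t: "0 < t" "t \<le> 2 * e * r" "t < T" using T r e by (auto simp: t_def)
    define l where "l = t / T"
    have l: "0 < l" "l < 1" "t = l * T" using t T by (simp_all add: l_def)
    have "ennreal (((1 - l) * f0 + l * f1) ^ ?n) \<le> emeasure lborel (shifted_inter K (t *\<^sub>R u))"
    proof (rule brunn_minkowski_powers[OF sets_K sets_shifted_inter sets_shifted_inter])
      fix x y assume xy: "x \<in> K" "y \<in> shifted_inter K (T *\<^sub>R u)"
      have "(1 - l) *\<^sub>R x + l *\<^sub>R y \<in> K" "(1 - l) *\<^sub>R x + l *\<^sub>R (y - T *\<^sub>R u) \<in> K"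
        using xy l by (auto intro!: convexD[OF convex_K] simp: shifted_inter_def)
      then show "(1 - l) *\<^sub>R x + l *\<^sub>R y \<in> shifted_inter K (t *\<^sub>R u)"
        by (simp add: shifted_inter_def l algebra_simps)
    qed (use l f0 f1 in \<open>simp_all add: emeasure_K emeasure_shifted_inter\<close>)
    then have "((1 - l) * f0 + l * f1) ^ ?n \<le> covariogram K (t *\<^sub>R u)"
      by (simp add: emeasure_shifted_inter covariogram_nonneg)
    \<comment> \<open>Bernoulli's inequality yields the tangent bound for the power at
      \<open>f0\<close>; \<open>d\<close> is the relative decrease of the root.\<close>
    moreover have "((1 - l) * f0 + l * f1) ^ ?n \<ge> f0 ^ ?n - ?n * f0 ^ (?n - 1) * (l * (f0 - f1))"
    proof -
      define d where "d = l * (f0 - f1) / f0"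
      have "l * (f0 - f1) \<le> 1 * f0" using l f0 f1 f10 by (intro mult_mono) auto
      then have "d \<le> 1" using f0 by (simp add: d_def)
      then have "1 + ?n * (- d) \<le> (1 + - d) ^ ?n"
        by (intro Bernoulli_inequality) simp
      then have "f0 ^ ?n * (1 - ?n * d) \<le> f0 ^ ?n * (1 - d) ^ ?n"
        using f0 by (intro mult_left_mono) auto
      also have "\<dots> = (f0 * (1 - d)) ^ ?n" by (simp add: power_mult_distrib)
      also have "f0 * (1 - d) = (1 - l) * f0 + l * f1"
        using f0 by (simp add: d_def field_simps)
      finally have "f0 ^ ?n - ?n * (f0 ^ ?n * d) \<le> ((1 - l) * f0 + l * f1) ^ ?n"
        by (simp add: algebra_simps)
      moreover have "f0 ^ ?n * d = f0 ^ (?n - 1) * (l * (f0 - f1))"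
        unfolding d_def f0_power using f0 by simp
      ultimately show ?thesis by (simp add: mult.assoc)
    qed
    moreover have "covariogram K (t *\<^sub>R u) + t * ((1 - e) ^ ?n * proj_volume K u) \<le> V"
      using u e r(2) t(1,2) by (rule covariogram_drop)
    \<comment> \<open>Both estimates of the loss are linear in \<open>t = l * T\<close>, so
      \<open>l\<close> cancels.\<close>
    ultimately have "l * ((1 - e) ^ ?n * (T * proj_volume K u)) \<le> l * (?n * f0 ^ (?n - 1) * (f0 - f1))"
      using f0 l by (simp add: algebra_simps)
    then show ?thesis using l by simp
  qed
  \<comment> \<open>Only the contraction factor still depends on \<open>e\<close>, and it tends to
    1.\<close>
  have "T * proj_volume K u \<le> ?n * f0 ^ (?n - 1) * (f0 - f1)"
  proof (rule tendsto_upperbound)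
    show "((\<lambda>e. (1 - e) ^ ?n * (T * proj_volume K u)) \<longlongrightarrow> T * proj_volume K u) (at_right 0)"
      by (rule tendsto_eq_intros refl | simp)+
    show "\<forall>\<^sub>F e in at_right 0. (1 - e) ^ ?n * (T * proj_volume K u) \<le> ?n * f0 ^ (?n - 1) * (f0 - f1)"
      unfolding eventually_at_right[OF zero_less_one] using main by (intro exI[of _ 1]) auto
  qed simp
  also have "\<dots> = ?n * V * (1 - f1 / f0)"
    using f0(1) by (simp add: f0_power field_simps flip: f0(2))
  also have "f1 / f0 = root ?n (covariogram K (T *\<^sub>R u) / V)"
    by (simp add: f0_def f1_def real_root_divide)
  also have "?n * V * (1 - \<dots>) \<le> ?n * V * (1 - root ?n (s / V))"
    using s V_pos by (intro mult_left_mono diff_left_mono) (auto simp: divide_right_mono)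
  finally show ?thesis .
qed

end

subsection \<open>Volumes of the level sets\<close>

lemma nn_integral_span_lborel_uminus:
  assumes "finite B" "f \<in> borel_measurable borel"
  shows "(\<integral>\<^sup>+x. f (- x) \<partial>span_lborel B) = (\<integral>\<^sup>+x. f x \<partial>span_lborel B)"
  using assms
proof (induction B arbitrary: f rule: finite_induct)
  case empty
  note [measurable] = empty.prems
  show ?case by (simp add: nn_integral_span_lborel_empty)
next
  case (insert u B)
  note [measurable] = insert.prems
  have meas: "(\<lambda>t. \<integral>\<^sup>+x. f (x + t *\<^sub>R u) \<partial>span_lborel B) \<in> borel_measurable borel"
    by (rule borel_measurable_nn_integral_span_lborel) (use insert.hyps in simp_all)
  have "(\<integral>\<^sup>+x. f (- x) \<partial>span_lborel (insert u B)) =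
      (\<integral>\<^sup>+t. (\<integral>\<^sup>+x. f (- x + (- t) *\<^sub>R u) \<partial>span_lborel B) \<partial>lborel)"
    using insert.hyps by (simp add: nn_integral_span_lborel_insert add.commute)
  also have "\<dots> = (\<integral>\<^sup>+t. (\<integral>\<^sup>+x. f (x + (- t) *\<^sub>R u) \<partial>span_lborel B) \<partial>lborel)"
    by (intro nn_integral_cong insert.IH) simp
  also have "\<dots> = (\<integral>\<^sup>+t. (\<integral>\<^sup>+x. f (x + t *\<^sub>R u) \<partial>span_lborel B) \<partial>lborel)"
    using nn_integral_lborel_uminus[OF meas] by simp
  also have "\<dots> = (\<integral>\<^sup>+x. f x \<partial>span_lborel (insert u B))"
    using insert.hyps by (simp add: nn_integral_span_lborel_insert)
  finally show ?case .
qed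

text \<open>The sections at \<open>v\<close> and \<open>- v\<close> are reflections of each other
  and have equal measure, and midpoints between them lie in the central section. Prekopa--Leindler
  with weight 1/2 concludes.\<close>

lemma central_section_maximal:
  fixes S :: "'a::euclidean_space set"
  assumes B: "finite B" and [measurable]: "S \<in> sets borel"
    and "convex S" and sym: "\<And>x. x \<in> S \<Longrightarrow> - x \<in> S"
  shows "emeasure (span_lborel B) {x. x + v \<in> S} \<le> emeasure (span_lborel B) S"
proof (rule dense_le)
  fix p assume p: "p < emeasure (span_lborel B) {x. x + v \<in> S}"
  then obtain a where a: "p < ennreal a" "ennreal a < emeasure (span_lborel B) {x. x + v \<in> S}"
    by (rule ennreal_between_real)
  then have "0 < a" by (metis ennreal_eq_0_iff not_less_zero linorder_not_le)
  have sym_iff: "- x - v \<in> S \<longleftrightarrow> x + v \<in> S" for x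
  proof -
    have "- x - v = - (x + v)" by simp
    then show ?thesis
      using sym[of "x + v"] sym[of "- (x + v)"] unfolding minus_minus by metis
  qed
  have "emeasure (span_lborel B) {x. x - v \<in> S} = (\<integral>\<^sup>+x. indicator S (x - v) \<partial>span_lborel B)"
    by (simp add: indicator_def flip: nn_integral_indicator)
  also have "\<dots> = (\<integral>\<^sup>+x. indicator S (- x - v) \<partial>span_lborel B)"
    using nn_integral_span_lborel_uminus[OF B, of "\<lambda>x. indicator S (x - v)"] by simp
  also have "\<dots> = (\<integral>\<^sup>+x. indicator S (x + v) \<partial>span_lborel B)"
    by (simp add: sym_iff indicator_def)
  also have "\<dots> = emeasure (span_lborel B) {x. x + v \<in> S}"
    by (simp add: indicator_def flip: nn_integral_indicator)
  finally have eq: "emeasure (span_lborel B) {x. x - v \<in> S} = emeasure (span_lborel B) {x. x + v \<in> S}" .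
  have "geom_le (1/2) (emeasure (span_lborel B) {x. x + v \<in> S})
      (emeasure (span_lborel B) {x. x - v \<in> S}) (emeasure (span_lborel B) S)"
  proof (rule prekopa_leindler_sets[OF B])
    fix x y assume "x \<in> {x. x + v \<in> S}" "y \<in> {x. x - v \<in> S}"
    then have "(1/2) *\<^sub>R (x + v) + (1/2) *\<^sub>R (y - v) \<in> S"
      using \<open>convex S\<close> by (intro convexD) auto
    then show "(1 - 1/2) *\<^sub>R x + (1/2) *\<^sub>R y \<in> S" by (simp add: algebra_simps)
  qed simp_all
  then have "ennreal (a powr (1 - 1/2) * a powr (1/2)) \<le> emeasure (span_lborel B) S"
    using a(2) \<open>0 < a\<close> by (intro geom_leD) (simp_all add: eq)
  also have "a powr (1 - 1/2) * a powr (1/2) = a" using \<open>0 < a\<close> by (simp flip: powr_add)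
  finally show "p \<le> emeasure (span_lborel B) S" using a by simp
qed

text \<open>Slicing across \<open>u\<close>: no slice exceeds the central one, and those at a height
  beyond \<open>w\<close> are null.\<close>

lemma emeasure_span_lborel_insert_le:
  fixes S :: "'a::euclidean_space set"
  assumes B: "finite B" and [measurable]: "S \<in> sets borel"
    and S: "convex S" "\<And>x. x \<in> S \<Longrightarrow> - x \<in> S"
    and u: "norm u = 1" "\<And>b. b \<in> B \<Longrightarrow> orthogonal u b"
    and width: "\<And>x. x \<in> S \<Longrightarrow> x \<in> span (insert u B) \<Longrightarrow> \<bar>x \<bullet> u\<bar> \<le> w" and "0 \<le> w"
  shows "emeasure (span_lborel (insert u B)) S \<le> ennreal (2 * w) * emeasure (span_lborel B) S"
proof -
  have "u \<notin> B" using u(2)[of u] u(1) by (auto simp: orthogonal_def)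
  have "emeasure (span_lborel (insert u B)) S = (\<integral>\<^sup>+x. indicator S x \<partial>span_lborel (insert u B))"
    by simp
  also have "\<dots> = (\<integral>\<^sup>+t. (\<integral>\<^sup>+x. indicator S (x + t *\<^sub>R u) \<partial>span_lborel B) \<partial>lborel)"
    using B \<open>u \<notin> B\<close> by (intro nn_integral_span_lborel_insert) simp_all
  also have "\<dots> \<le> (\<integral>\<^sup>+t. emeasure (span_lborel B) S * indicator {- w..w} t \<partial>lborel)"
  proof (intro nn_integral_mono)
    fix t
    show "(\<integral>\<^sup>+x. indicator S (x + t *\<^sub>R u) \<partial>span_lborel B) \<le> emeasure (span_lborel B) S * indicator {- w..w} t"
    proof (cases "t \<in> {- w..w}")
      case True
      have "(\<integral>\<^sup>+x. indicator S (x + t *\<^sub>R u) \<partial>span_lborel B) = emeasure (span_lborel B) {x. x + t *\<^sub>R u \<in> S}"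
        by (simp add: indicator_def flip: nn_integral_indicator)
      also have "\<dots> \<le> emeasure (span_lborel B) S"
        by (rule central_section_maximal[OF B assms(2) S])
      finally show ?thesis using True by simp
    next
      case False
      \<comment> \<open>\<open>width\<close> speaks only of points in the span, so the integrand is
        shown to vanish almost everywhere.\<close>
      have "(\<integral>\<^sup>+x. indicator S (x + t *\<^sub>R u) \<partial>span_lborel B) = (\<integral>\<^sup>+x. 0 \<partial>span_lborel B)"
      proof (rule nn_integral_cong_AE, use AE_span_lborel in eventually_elim)
        fix x assume x: "x \<in> span B"
        have "x + t *\<^sub>R u \<in> span (insert u B)"
        proof (intro span_add span_scale)
          show "x \<in> span (insert u B)" using x span_mono[OF subset_insertI] by blast
          show "u \<in> span (insert u B)" by (simp add: span_base)
        qed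
        moreover have "orthogonal u x"
          using x u(2) by (rule orthogonal_to_span)
        then have "(x + t *\<^sub>R u) \<bullet> u = t"
          using u(1) by (simp add: inner_add_left orthogonal_def inner_commute[of x u] norm_eq_1)
        ultimately show "indicator S (x + t *\<^sub>R u) = (0::ennreal)"
          using width[of "x + t *\<^sub>R u"] False by (simp add: indicator_def abs_le_iff) linarith
      qed
      then show ?thesis by simp
    qed
  qed
  also have "\<dots> = ennreal (2 * w) * emeasure (span_lborel B) S"
    using \<open>0 \<le> w\<close> by (simp add: nn_integral_cmult mult.commute)
  finally show ?thesis .
qed

text \<open>The substitution \<open>s = V * x ^ n\<close> produces \<open>V * n\<close> times the
  Beta integral with parameters \<open>n\<close> and \<open>n + 1\<close>; \<open>n\<close> times
  its value is the reciprocal of the binomial coefficient.\<close>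

lemma integral_one_minus_root:
  fixes V :: real
  assumes V: "0 < V" and n: "0 < n"
  shows "((\<lambda>s. (1 - root n (s / V)) ^ n) has_integral V / ((2 * n) choose n)) {0..V}"
proof -
  let ?f = "\<lambda>s. (1 - root n (s / V)) ^ n"
  have cont: "continuous_on {0..V} ?f"
    by (intro continuous_intros) (use V in auto)
  have "((\<lambda>x. (V * (real n * x ^ (n - 1))) *\<^sub>R ?f (V * x ^ n)) has_integral
      integral {V * 0 ^ n..V * 1 ^ n} ?f) {0..1}"
  proof (rule has_integral_substitution[where c = 0 and d = V])
    show "(\<lambda>x. V * x ^ n) ` {0..1} \<subseteq> {0..V}"
      using V by (auto simp: mult_le_cancel_left1 power_le_one)
  qed (use V n cont in \<open>auto intro!: derivative_eq_intros simp: zero_power\<close>)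
  then have 1: "((\<lambda>x. (V * (real n * x ^ (n - 1))) * (1 - root n (x ^ n)) ^ n) has_integral integral {0..V} ?f) {0..1}"
    using V n by (simp add: zero_power)
  have "((\<lambda>x. V * real n * (x powr (real n - 1) * (1 - x) powr (real (Suc n) - 1))) has_integral
      V * real n * Beta (real n) (real (Suc n))) {0..1}"
    using n by (intro has_integral_mult_right has_integral_Beta_real) auto
  \<comment> \<open>The endpoints are left out: for \<open>n = 1\<close> the integrands differ at 0,
    since \<open>0 powr 0 = 0\<close>.\<close>
  then have 2: "((\<lambda>x. (V * (real n * x ^ (n - 1))) * (1 - root n (x ^ n)) ^ n) has_integral
      V * real n * Beta (real n) (real (Suc n))) {0..1}"
  proof (rule has_integral_spike_finite[rotated 2, where S = "{0, 1}"])
    fix x :: real assume "x \<in> {0..1} - {0, 1}"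
    then have x: "0 < x" "x < 1" by auto
    have "x powr (real n - 1) = x ^ (n - 1)"
      using x n by (simp add: powr_realpow[symmetric] of_nat_diff)
    moreover have "(1 - x) powr (real (Suc n) - 1) = (1 - x) ^ n"
      using x by (simp add: powr_realpow)
    ultimately show "(V * (real n * x ^ (n - 1))) * (1 - root n (x ^ n)) ^ n =
        V * real n * (x powr (real n - 1) * (1 - x) powr (real (Suc n) - 1))"
      using x n by (simp add: real_root_power_cancel)
  qed simp
  have "real n * Beta (real n) (real (Suc n)) = 1 / ((2 * n) choose n)"
  proof -
    obtain m where m: "n = Suc m" using n by (cases n) auto
    have "Gamma (real n) = fact m" "Gamma (real (Suc n)) = fact n" "Gamma (real n + real (Suc n)) = fact (2 * n)"
      using Gamma_fact[of m, where 'a = real] Gamma_fact[of n, where 'a = real] Gamma_fact[of "2 * n", where 'a = real]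
      by (simp_all add: m algebra_simps)
    then have "real n * Beta (real n) (real (Suc n)) = fact n * fact n / fact (2 * n)"
      unfolding Beta_def by (simp add: m)
    also have "\<dots> = 1 / ((2 * n) choose n)"
      by (simp add: binomial_fact)
    finally show ?thesis .
  qed
  with has_integral_unique[OF 1 2] have "integral {0..V} ?f = V / ((2 * n) choose n)"
    by (simp add: mult.assoc)
  then show ?thesis
    using integrable_integral[OF integrable_continuous_real[OF cont]] by simp
qed

section \<open>The greedy frame and the bound on the LW-constant\<close>

context body
begin

abbreviation (input) "level s \<equiv> {x. s < covariogram K x}"

lemma sets_level: "level s \<in> sets borel"
  by measurable

text \<open>\<open>K\<close> lies in a cylinder of height \<open>2 * R\<close> over each of its
  projections. Uniformity in \<open>u\<close> gives the greedy choice a positive infimum and keeps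
  \<open>LW_ratio\<close> bounded.\<close>

lemma proj_volume_lower_bound:
  "\<exists>d>0. \<forall>u. norm u = 1 \<longrightarrow> d \<le> proj_volume K u"
proof -
  obtain R where R: "\<And>x. x \<in> K \<Longrightarrow> norm x \<le> R" "0 < R"
    using compact_imp_bounded[OF compact_K] bounded_pos by metis
  show ?thesis
  proof (intro exI[of _ "V / (2 * R)"] conjI allI impI)
    show "0 < V / (2 * R)" using V_pos R by simp
    fix u :: 'a assume u: "norm u = 1"
    let ?P = "hyperplane_proj u ` K"
    have P: "?P \<in> sets borel"
      using compact_K u by (intro borel_compact compact_hyperplane_proj)
    have [measurable]: "hyperplane_proj u \<in> borel_measurable borel"
      using u by (intro borel_measurable_continuous_onI continuous_hyperplane_proj)
    note P[measurable]
    have "- R \<le> x \<bullet> u \<and> x \<bullet> u \<le> R" if "x \<in> K" for x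
      using Cauchy_Schwarz_ineq2[of x u] R(1)[OF that] u by simp linarith
    then have "emeasure lborel K \<le> emeasure lborel {x. hyperplane_proj u x \<in> ?P \<and> x \<bullet> u \<in> {- R..R}}"
      by (intro emeasure_mono) auto
    also have "\<dots> = ennreal (R - - R) * emeasure (subspace_lborel ({u}\<^sup>\<bottom>)) ?P"
      using R by (intro emeasure_lborel_cylinder u P) simp
    also have "\<dots> = ennreal (2 * R * proj_volume K u)"
      using R by (simp add: emeasure_hyperplane_proj[OF compact_K u] ennreal_mult')
    finally have "V \<le> 2 * R * proj_volume K u"
      using R by (simp add: emeasure_K proj_volume_def)
    then show "V / (2 * R) \<le> proj_volume K u"
      using R by (simp add: field_simps)
  qed
qed

lemma proj_volume_pos: "norm u = 1 \<Longrightarrow> 0 < proj_volume K u"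
  using proj_volume_lower_bound by (meson less_le_trans)

text \<open>The function \<open>c\<close> of the overview: for \<open>0 \<le> s\<close>, the set
  \<open>level s\<close> extends at most \<open>reach s / proj_volume K u\<close> in direction
  \<open>u\<close>.\<close>

definition "reach s = DIM('a) * V * (1 - root DIM('a) (s / V))"

lemma reach_measurable [measurable]: "reach \<in> borel_measurable borel"
proof -
  have "reach = (\<lambda>s. DIM('a) * V * (1 - root DIM('a) (s / V)))"
    by (simp add: fun_eq_iff reach_def)
  then show ?thesis by simp
qed

lemma reach_nonneg: "s \<le> V \<Longrightarrow> 0 \<le> reach s"
  using V_pos by (simp add: reach_def)

lemma level_norm_bound:
  assumes x: "x \<in> level s" "x \<noteq> 0" and s: "0 \<le> s"
  shows "norm x * proj_volume K (x /\<^sub>R norm x) \<le> reach s"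
  unfolding reach_def using x s by (intro covariogram_bound) auto

(* Choose u in W with almost minimal projection volume: then the level sets meet W within the slab
   of half-width (1 + e) * reach s / proj_volume K u. Continue in the complement of u in W. *)
lemma greedy_frame:
  assumes "subspace W" and e: "0 < e"
  shows "\<exists>B. orthonormal_basis_of W B \<and> (\<forall>s. 0 \<le> s \<longrightarrow> s \<le> V \<longrightarrow>
    emeasure (span_lborel B) (level s) \<le> ennreal (\<Prod>u\<in>B. 2 * (1 + e) * reach s / proj_volume K u))"
  using assms(1)
proof (induction "dim W" arbitrary: W)
  case 0
  then have "W = {0}" using subspace_0[OF 0(2)] by auto
  \<comment> \<open>In dimension 0 the measure is a unit point mass and the product is empty, so the
    bound is 1.\<close>
  moreover have "emeasure (span_lborel {}) (level s) \<le> 1" for s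
  proof -
    have "emeasure (span_lborel {}) (level s) = (\<integral>\<^sup>+x. indicator (level s) x \<partial>span_lborel {})"
      using sets_level[of s] by simp
    also have "\<dots> = indicator (level s) 0"
      using sets_level[of s] by (intro nn_integral_span_lborel_empty) simp
    also have "\<dots> \<le> 1" by (simp add: indicator_def)
    finally show ?thesis .
  qed
  ultimately show ?case by (intro exI[of _ "{}"]) (simp add: orthonormal_basis_of_def)
next
  case (Suc k)
  obtain d where d: "0 < d" "\<And>u. norm u = 1 \<Longrightarrow> d \<le> proj_volume K u"
    using proj_volume_lower_bound by blast
  let ?Z = "proj_volume K ` {u \<in> W. norm u = 1}"
  obtain w where w: "w \<in> W" "w \<noteq> 0"
    using Suc(2) by (metis dim_eq_0 nat.distinct(1) subset_iff singleton_iff)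
  then have "w /\<^sub>R norm w \<in> {u \<in> W. norm u = 1}"
    using Suc.prems by (simp add: subspace_scale)
  then have ne: "?Z \<noteq> {}" by blast
  have bdd: "bdd_below ?Z" using d by (intro bdd_belowI[of _ d]) auto
  have "d \<le> Inf ?Z" using ne d by (intro cInf_greatest) auto
  \<comment> \<open>As the infimum is positive, the factor \<open>1 + e\<close> leaves room for an
    actual direction without attainment of the minimum.\<close>
  then have "Inf ?Z < (1 + e) * Inf ?Z" using d e by simp
  then obtain u where u: "u \<in> W" "norm u = 1" "proj_volume K u < (1 + e) * Inf ?Z"
    using cInf_lessD[OF ne] by auto
  have u_min: "proj_volume K u \<le> (1 + e) * proj_volume K v" if "v \<in> W" "norm v = 1" for v
  proof -
    have "Inf ?Z \<le> proj_volume K v" using that bdd by (intro cInf_lower) auto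
    then have "(1 + e) * Inf ?Z \<le> (1 + e) * proj_volume K v" using e by simp
    with u(3) show ?thesis by linarith
  qed
  have sub: "subspace (W \<inter> {u}\<^sup>\<bottom>)"
    using Suc.prems subspace_orthogonal_comp by (rule subspace_inter)
  \<comment> \<open>\<open>B0\<close> only serves to count dimensions; the basis with the volume
    bound comes from the induction hypothesis.\<close>
  obtain B0 where B0: "orthonormal_basis_of (W \<inter> {u}\<^sup>\<bottom>) B0"
    using orthonormal_basis_of_exists[OF sub] by blast
  have "Suc (dim (W \<inter> {u}\<^sup>\<bottom>)) = dim W"
    using orthonormal_basis_of_insert[OF Suc.prems u(1,2) B0] orthonormal_basis_of_finite[OF B0]
      orthonormal_basis_of_card[OF B0] orthonormal_basis_of_card[of W "insert u B0"]
    by simp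
  then obtain B where B: "orthonormal_basis_of (W \<inter> {u}\<^sup>\<bottom>) B"
    and IH: "\<And>s. 0 \<le> s \<Longrightarrow> s \<le> V \<Longrightarrow>
      emeasure (span_lborel B) (level s) \<le> ennreal (\<Prod>u\<in>B. 2 * (1 + e) * reach s / proj_volume K u)"
    using Suc(1)[of "W \<inter> {u}\<^sup>\<bottom>"] Suc(2) sub by auto
  note ins = orthonormal_basis_of_insert[OF Suc.prems u(1,2) B]
  show ?case
  proof (intro exI[of _ "insert u B"] conjI allI impI)
    show "orthonormal_basis_of W (insert u B)" by (rule ins)
    fix s assume s: "0 \<le> s" "s \<le> V"
    let ?w = "(1 + e) * reach s / proj_volume K u"
    have w: "0 \<le> ?w" using e reach_nonneg[OF s(2)] by (simp add: proj_volume_def)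
    have "emeasure (span_lborel (insert u B)) (level s) \<le> ennreal (2 * ?w) * emeasure (span_lborel B) (level s)"
    proof (rule emeasure_span_lborel_insert_le)
      show "orthogonal u b" if "b \<in> B" for b
        using B that span_base[of b B] by (auto simp: orthonormal_basis_of_def orthogonal_comp_def)
      fix x assume x: "x \<in> level s" "x \<in> span (insert u B)"
      show "\<bar>x \<bullet> u\<bar> \<le> ?w"
      proof (cases "x = 0")
        case False
        \<comment> \<open>The direction of \<open>x\<close> was a candidate when \<open>u\<close>
          was chosen, so its projection volume is not much smaller; this bounds
          \<open>norm x\<close> in terms of \<open>u\<close>.\<close>
        have "x \<in> W" using x(2) ins(2) by (simp add: orthonormal_basis_of_def)
        then have "proj_volume K u \<le> (1 + e) * proj_volume K (x /\<^sub>R norm x)"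
          using False Suc.prems by (intro u_min) (auto intro: subspace_scale)
        then have "norm x * proj_volume K u \<le> norm x * ((1 + e) * proj_volume K (x /\<^sub>R norm x))"
          by (intro mult_left_mono) auto
        also have "\<dots> = (1 + e) * (norm x * proj_volume K (x /\<^sub>R norm x))" by simp
        also have "\<dots> \<le> (1 + e) * reach s"
          using e level_norm_bound[OF x(1) False s(1)] by (intro mult_left_mono) auto
        finally have "norm x \<le> ?w"
          using proj_volume_pos[OF u(2)] by (simp add: field_simps)
        then show ?thesis using Cauchy_Schwarz_ineq2[of x u] u(2) by simp
      qed (use w in simp)
    qed (use orthonormal_basis_of_finite[OF B] sets_level covariogram_superlevel_convex[OF s(1)]
        covariogram_uminus u(2) w in auto)
    also have "\<dots> \<le> ennreal (2 * ?w) * ennreal (\<Prod>u\<in>B. 2 * (1 + e) * reach s / proj_volume K u)"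
      by (intro mult_left_mono IH s) simp
    also have "\<dots> = ennreal (\<Prod>u\<in>insert u B. 2 * (1 + e) * reach s / proj_volume K u)"
      using w ins(1) orthonormal_basis_of_finite[OF B]
      by (subst ennreal_mult'[symmetric]) (simp_all add: prod.insert mult.assoc del: distrib_left_numeral)
    finally show "emeasure (span_lborel (insert u B)) (level s)
        \<le> ennreal (\<Prod>u\<in>insert u B. 2 * (1 + e) * reach s / proj_volume K u)" .
  qed
qed

text \<open>The layer cake formula for the covariogram; it never exceeds \<open>V\<close>, so the
  levels from \<open>V\<close> on are empty.\<close>

lemma V_squared_layers:
  "ennreal (V\<^sup>2) = (\<integral>\<^sup>+s. emeasure lborel (level s) * indicator {0..V} s \<partial>lborel)"
proof -
  have [measurable]: "(\<lambda>(s, x). indicator (level s) x * indicator {0..V} s :: ennreal) \<in> borel_measurable (borel \<Otimes>\<^sub>M borel)"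
    unfolding indicator_def by measurable
  have "ennreal (V\<^sup>2) = (\<integral>\<^sup>+x. ennreal (covariogram K x) \<partial>lborel)"
    by (simp add: nn_integral_covariogram)
  also have "\<dots> = (\<integral>\<^sup>+x. (\<integral>\<^sup>+s. indicator (level s) x * indicator {0..V} s \<partial>lborel) \<partial>lborel)"
  proof (intro nn_integral_cong)
    fix x
    have "ennreal (covariogram K x) = (\<integral>\<^sup>+s. indicator {0..<covariogram K x} s \<partial>lborel)"
      by (simp add: covariogram_nonneg)
    also have "\<dots> = (\<integral>\<^sup>+s. indicator (level s) x * indicator {0..V} s \<partial>lborel)"
      using covariogram_le[of x] by (intro nn_integral_cong) (auto simp: indicator_def)
    finally show "ennreal (covariogram K x) = (\<integral>\<^sup>+s. indicator (level s) x * indicator {0..V} s \<partial>lborel)" .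
  qed
  also have "\<dots> = (\<integral>\<^sup>+s. (\<integral>\<^sup>+x. indicator (level s) x * indicator {0..V} s \<partial>lborel) \<partial>lborel)"
    by (rule lborel_pair.Fubini') measurable
  also have "\<dots> = (\<integral>\<^sup>+s. emeasure lborel (level s) * indicator {0..V} s \<partial>lborel)"
    by (intro nn_integral_cong) (simp add: nn_integral_multc)
  finally show ?thesis .
qed

lemma nn_integral_reach:
  "(\<integral>\<^sup>+s. ennreal (reach s ^ DIM('a)) * indicator {0..V} s \<partial>lborel) =
    ennreal ((DIM('a) * V) ^ DIM('a) * (V / ((2 * DIM('a)) choose DIM('a))))"
proof -
  have "((\<lambda>s. reach s ^ DIM('a)) has_integral
      (DIM('a) * V) ^ DIM('a) * (V / ((2 * DIM('a)) choose DIM('a)))) {0..V}"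
    unfolding reach_def power_mult_distrib[of "DIM('a) * V"]
    using V_pos by (intro has_integral_mult_right integral_one_minus_root) auto
  then have "(\<integral>\<^sup>+s. ennreal (indicator {0..V} s * reach s ^ DIM('a)) \<partial>lborel) =
    ennreal ((DIM('a) * V) ^ DIM('a) * (V / ((2 * DIM('a)) choose DIM('a))))"
    by (rule nn_integral_has_integral_lebesgue[rotated]) (simp add: reach_nonneg)
  moreover have "ennreal (indicator {0..V} s * reach s ^ DIM('a)) = ennreal (reach s ^ DIM('a)) * indicator {0..V} s" for s
    by (simp add: indicator_def)
  ultimately show ?thesis by simp
qed

text \<open>One greedy frame of the whole space serves all levels at once, so its volume bounds can
  be integrated over \<open>s\<close> and compared with \<open>V\<^sup>2\<close>.\<close>

lemma LW_ratio_lower_bound: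
  assumes e: "0 < e"
  obtains F where "frame F"
    "real ((2 * DIM('a)) choose DIM('a)) / (2 * real DIM('a)) ^ DIM('a) / (1 + e) ^ DIM('a) \<le> LW_ratio K F"
proof -
  let ?n = "DIM('a)" and ?C = "real ((2 * DIM('a)) choose DIM('a))"
  obtain F where F: "frame F" and le: "\<And>s. 0 \<le> s \<Longrightarrow> s \<le> V \<Longrightarrow>
    emeasure (span_lborel F) (level s) \<le> ennreal (\<Prod>u\<in>F. 2 * (1 + e) * reach s / proj_volume K u)"
    using greedy_frame[OF subspace_UNIV e] by blast
  have card: "card F = ?n" using orthonormal_basis_of_card[OF F] by simp
  define P where "P = (\<Prod>u\<in>F. proj_volume K u)"
  have P: "0 < P"
    unfolding P_def using F proj_volume_pos by (intro prod_pos) (auto simp: orthonormal_basis_of_def)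
  have C: "0 < ?C" by simp
  let ?A = "(2 * (1 + e)) ^ ?n / P"
  have "ennreal (V\<^sup>2) \<le> (\<integral>\<^sup>+s. ennreal ?A * (ennreal (reach s ^ ?n) * indicator {0..V} s) \<partial>lborel)"
    unfolding V_squared_layers
  proof (intro nn_integral_mono)
    fix s
    have "emeasure lborel (level s) \<le> ennreal ?A * ennreal (reach s ^ ?n)" if "0 \<le> s" "s \<le> V"
    proof -
      have "(\<Prod>u\<in>F. 2 * (1 + e) * reach s / proj_volume K u) = ?A * reach s ^ ?n"
        by (simp add: prod_dividef card P_def power_mult_distrib)
      then have "emeasure lborel (level s) \<le> ennreal (?A * reach s ^ ?n)"
        using le[OF that] by (simp only: span_lborel_frame[OF F])
      also have "\<dots> = ennreal ?A * ennreal (reach s ^ ?n)"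
        using P e by (intro ennreal_mult') simp
      finally show ?thesis .
    qed
    then show "emeasure lborel (level s) * indicator {0..V} s \<le> ennreal ?A * (ennreal (reach s ^ ?n) * indicator {0..V} s)"
      by (auto simp: indicator_def)
  qed
  also have "\<dots> = ennreal ?A * ennreal ((?n * V) ^ ?n * (V / ?C))"
    by (subst nn_integral_cmult) (simp_all add: nn_integral_reach)
  also have "\<dots> = ennreal (?A * ((?n * V) ^ ?n * (V / ?C)))"
    using P e by (intro ennreal_mult'[symmetric]) simp
  finally have "V\<^sup>2 \<le> ?A * ((?n * V) ^ ?n * (V / ?C))"
    using P e V_pos by (subst (asm) ennreal_le_iff) auto
  \<comment> \<open>Of the \<open>DIM('a) + 1\<close> factors \<open>V\<close>, two match the
    left-hand side and the others form the numerator of \<open>LW_ratio\<close>.\<close>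
  also have "\<dots> = V\<^sup>2 * ((2 * ?n) ^ ?n * (1 + e) ^ ?n / ?C * (V ^ (?n - 1) / P))"
    using power_eq_if[of V ?n] by (simp add: power_mult_distrib power2_eq_square mult_ac
        del: distrib_left_numeral distrib_right_numeral)
  finally have "1 \<le> (2 * ?n) ^ ?n * (1 + e) ^ ?n / ?C * (V ^ (?n - 1) / P)"
    using V_pos by (metis mult.right_neutral mult_le_cancel_left_pos zero_less_power)
  then have "?C / (2 * real ?n) ^ ?n / (1 + e) ^ ?n \<le> V ^ (?n - 1) / P"
    using e P C by (simp add: field_simps)
  with F show thesis by (intro that) (simp_all add: LW_ratio_def P_def)
qed

text \<open>Makes the \<open>SUP\<close> in \<open>LW_constant\<close> a genuine upper bound: the
  denominators are uniformly bounded away from 0.\<close>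

lemma LW_ratio_bdd_above: "bdd_above (LW_ratio K ` {F. frame F})"
proof -
  obtain d where d: "0 < d" "\<And>u. norm u = 1 \<Longrightarrow> d \<le> proj_volume K u"
    using proj_volume_lower_bound by blast
  show ?thesis
  proof (rule bdd_aboveI2)
    fix F :: "'a set" assume "F \<in> {F. frame F}"
    then have F: "frame F" by simp
    have "d ^ card F \<le> (\<Prod>u\<in>F. proj_volume K u)"
      using d F prod_mono[of F "\<lambda>_. d" "proj_volume K"] by (auto simp: orthonormal_basis_of_def)
    then show "LW_ratio K F \<le> V ^ (DIM('a) - 1) / d ^ DIM('a)"
      unfolding LW_ratio_def using d(1) orthonormal_basis_of_card[OF F]
      by (intro frac_le) auto
  qed
qed

text \<open>The frame varies with \<open>e\<close> but \<open>LW_constant K\<close> does not, so the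
  loss \<open>(1 + e) ^ DIM('a)\<close> disappears as \<open>e\<close> tends to 0.\<close>

lemma LW_constant_lower_bound:
  "real ((2 * DIM('a)) choose DIM('a)) / (2 * real DIM('a)) ^ DIM('a) \<le> LW_constant K" (is "?c \<le> _")
proof (rule tendsto_upperbound)
  show "((\<lambda>e. ?c / (1 + e) ^ DIM('a)) \<longlongrightarrow> ?c) (at_right 0)"
    by (rule tendsto_eq_intros refl | simp)+
  have "?c / (1 + e) ^ DIM('a) \<le> LW_constant K" if "0 < e" for e
  proof -
    obtain F where "frame F" "?c / (1 + e) ^ DIM('a) \<le> LW_ratio K F"
      using LW_ratio_lower_bound[OF \<open>0 < e\<close>] .
    then show ?thesis
      unfolding LW_constant_def by (intro cSUP_upper2[OF LW_ratio_bdd_above]) auto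
  qed
  then show "\<forall>\<^sub>F e in at_right 0. ?c / (1 + e) ^ DIM('a) \<le> LW_constant K"
    unfolding eventually_at_right[OF zero_less_one] by (intro exI[of _ 1]) auto
qed simp

end

theorem theorem5:
  fixes K :: "(real ^ 'n) set"
  assumes "CARD('n) \<ge> 2"
    and "convex_body K"
  shows "LW_constant K \<ge> real ((2 * CARD('n)) choose CARD('n)) / (2 * real CARD('n)) ^ CARD('n)"
proof -
  interpret body K by unfold_locales (rule assms(2))
  show ?thesis using LW_constant_lower_bound by simp
qed

end
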